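(* Let $m,n\ge 1$ be integers, $\alpha\in\mathbb{R}$, $B\in M_{m,n}$, and let $\Phi^{-}_{\alpha,B}:M_n\to M_m$ be $\Phi^{-}_{\alpha,B}(Y)=\alpha\,\mathrm{tr}(Y)I_m-BYB^*$. Let $A,X,C\in M_n$ be such that $\begin{bmatrix} A & X \\ X^* & C \end{bmatrix}$ is positive semidefinite. If $\alpha\ge\frac{m+1}{2}\sigma_1(B)^2$, then for every $j\in\{1,\ldots,m\}$, \[2\sigma_j(\Phi^{-}_{\alpha,B}(X))\le\sigma_j(\Phi^{-}_{\alpha,B}(A+C)).\]
   Context: $M_{m,n}$ is the set of $m\times n$ complex matrices, $M_n=M_{n,n}$. Singular values are listed in decreasing order $\sigma_1\ge\sigma_2\ge\cdots$. *)

theory Defs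
  imports
    "Jordan_Normal_Form.Schur_Decomposition"
    "HOL-Computational_Algebra.Computational_Algebra"
begin

definition trace_mat :: "complex mat \<Rightarrow> complex" where
  "trace_mat A = (\<Sum>i<dim_row A. A $$ (i, i))"

text \<open>Since \<open>x \<bullet>c y = (\<Sum>i. x\<^sub>i * cnj y\<^sub>i)\<close>, the number \<open>(A *\<^sub>v v) \<bullet>c v\<close> is \<open>v\<^sup>* A v\<close>.
  The order is the one on the complex numbers: \<open>0 \<le> z\<close> says that \<open>z\<close> is real and nonnegative.\<close>

definition positive_semidefinite :: "complex mat \<Rightarrow> bool" where
  "positive_semidefinite A \<longleftrightarrow>
     square_mat A \<and> mat_adjoint A = A \<and>
     (\<forall>v \<in> carrier_vec (dim_row A). 0 \<le> (A *\<^sub>v v) \<bullet>c v)"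

text \<open>The square roots of the eigenvalues of \<open>A\<^sup>* A\<close>, with algebraic multiplicity and in decreasing
  order. These eigenvalues are real and nonnegative, so \<open>Re\<close> loses nothing. The list
  has length \<open>dim_col A\<close>; if \<open>A\<close> has fewer rows than columns, its surplus entries are zeros.\<close>

definition singular_values :: "complex mat \<Rightarrow> real list" where
  "singular_values A =
     rev (sorted_list_of_multiset
       (image_mset (\<lambda>z. sqrt (Re z)) (proots (char_poly (mat_adjoint A * A)))))"

text \<open>Singular values are numbered from 1; \<open>singular_value A j\<close> is meaningful for
  \<open>j \<in> {1..dim_col A}\<close>.\<close>

definition singular_value :: "complex mat \<Rightarrow> nat \<Rightarrow> real" where
  "singular_value A j = singular_values A ! (j - 1)"

lemma mat_adjoint_dims [simp]:
  "dim_row (mat_adjoint A) = dim_col A" "dim_col (mat_adjoint A) = dim_row A"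
  by (simp_all add: mat_adjoint_def)

lemma mat_adjoint_index [simp]:
  assumes "i < dim_col A" "j < dim_row A"
  shows "mat_adjoint A $$ (i, j) = conjugate (A $$ (j, i))"
  using assms by (simp add: mat_adjoint_def mat_of_rows_def)

lemma length_singular_values: "length (singular_values A) = dim_col A"
proof -
  have "mat_adjoint A * A \<in> carrier_mat (dim_col A) (dim_col A)"
    by (intro carrier_matI) simp_all
  then have "degree (char_poly (mat_adjoint A * A)) = dim_col A"
    using degree_monic_char_poly by blast
  then show ?thesis
    by (simp add: singular_values_def size_proots_complex flip: size_mset)
qed

definition Phi_minus :: "real \<Rightarrow> complex mat \<Rightarrow> complex mat \<Rightarrow> complex mat" where
  "Phi_minus \<alpha> B Y =
     (complex_of_real \<alpha> * trace_mat Y) \<cdot>\<^sub>m 1\<^sub>m (dim_row B) - B * Y * mat_adjoint B"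

end

theory Submission
  imports Defs "HOL-Analysis.L2_Norm"
begin

text \<open>
  Write \<open>T = \<Phi>(A + C)\<close>, \<open>\<tau> = \<sigma>\<^sub>j(T)\<close>, and let \<open>v\<^sub>i\<close>, \<open>u\<^sub>i\<close> be singular vectors of \<open>\<Phi>(X)\<close>. Replacing \<open>X\<close>
  by \<open>\<omega>X\<close> with \<open>\<bar>\<omega>\<bar> = 1\<close>, assume \<open>tr X \<ge> 0\<close>. Some nonzero \<open>c \<in> \<complex>\<^sup>j\<close> makes \<open>u + v\<close>, with
  \<open>u = \<Sum>c\<^sub>iu\<^sub>i\<close> and \<open>v = \<Sum>c\<^sub>iv\<^sub>i\<close>, orthogonal to the first \<open>j - 1\<close> singular vectors of \<open>T\<close>. Then
  \<open>Re u\<^sup>*\<Phi>(X)v \<ge> \<sigma>\<^sub>j(\<Phi>(X)) \<bar>c\<bar>\<^sup>2\<close>, and \<open>w\<^sup>*Tw \<le> \<tau>\<close> for the unit vector \<open>w\<close> along \<open>u + v\<close>. It remains to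
  show \<open>2 Re u\<^sup>*\<Phi>(X)v \<le> w\<^sup>*Tw (\<bar>u\<bar>\<^sup>2 + \<bar>v\<bar>\<^sup>2) / 2\<close> whenever \<open>u + v\<close> is a multiple of \<open>w\<close>.

  This is linear in the positive semidefinite block matrix, hence reduces to \<open>A = pp\<^sup>*\<close>, \<open>X = pq\<^sup>*\<close>,
  \<open>C = qq\<^sup>*\<close>, provided that multiples of \<open>Re tr X \<ge> 0\<close> and \<open>Im tr X = 0\<close> are added, as these hold
  only after summation. In terms of \<open>a = p + q\<close>, \<open>b = p - q\<close>, \<open>x = u + v\<close>, \<open>y = u - v\<close>
  the rank-one inequality follows from Cauchy--Schwarz for exterior products,
  \<open>\<bar>\<langle>x \<and> a, b \<and> y\<rangle>\<bar> \<le> \<bar>x \<and> a\<bar> \<bar>b \<and> y\<bar>\<close>. For \<open>m \<ge> 2\<close> the constant \<open>\<alpha> \<ge> 3/2 \<sigma>\<^sub>1(B)\<^sup>2\<close> is large enough;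
  for \<open>m = 1\<close> the vectors \<open>x\<close> and \<open>y\<close> are collinear and \<open>\<alpha> \<ge> \<sigma>\<^sub>1(B)\<^sup>2\<close> suffices.
\<close>

unbundle no fps_syntax

subsection \<open>Inner products and Gram determinants\<close>

text \<open>Vectors are functions on the naturals of which only the values below \<open>n\<close>
  count, so that linear combinations are plain lambda terms. The form is conjugate-linear in its
  first argument.\<close>

definition hinner :: "nat \<Rightarrow> (nat \<Rightarrow> complex) \<Rightarrow> (nat \<Rightarrow> complex) \<Rightarrow> complex" where
  "hinner n f g = (\<Sum>i<n. cnj (f i) * g i)"

definition hnorm2 :: "nat \<Rightarrow> (nat \<Rightarrow> complex) \<Rightarrow> real" where
  "hnorm2 n f = (\<Sum>i<n. (cmod (f i))\<^sup>2)"

text \<open>The Gram determinant of two vectors, that is, the squared norm of their exterior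
  product.\<close>

definition gram2 :: "nat \<Rightarrow> (nat \<Rightarrow> complex) \<Rightarrow> (nat \<Rightarrow> complex) \<Rightarrow> real" where
  "gram2 n f g = hnorm2 n f * hnorm2 n g - (cmod (hinner n f g))\<^sup>2"

lemma hinner_self: "hinner n f f = of_real (hnorm2 n f)"
  unfolding hinner_def hnorm2_def
  by (simp add: complex_norm_square mult.commute del: of_real_power)

lemma hnorm2_nonneg [simp]: "0 \<le> hnorm2 n f"
  unfolding hnorm2_def by (simp add: sum_nonneg)

lemma hnorm2_eq_0_iff: "hnorm2 n f = 0 \<longleftrightarrow> (\<forall>i<n. f i = 0)"
  unfolding hnorm2_def by (subst sum_nonneg_eq_0_iff) auto

lemma cnj_hinner: "cnj (hinner n f g) = hinner n g f"
  unfolding hinner_def by (simp add: mult.commute)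

lemma cmod_hinner_commute: "cmod (hinner n f g) = cmod (hinner n g f)"
  by (metis cnj_hinner complex_mod_cnj)

lemma hinner_add_left: "hinner n (\<lambda>i. f i + g i) h = hinner n f h + hinner n g h"
  unfolding hinner_def by (simp add: sum.distrib algebra_simps)

lemma hinner_add_right: "hinner n h (\<lambda>i. f i + g i) = hinner n h f + hinner n h g"
  unfolding hinner_def by (simp add: sum.distrib algebra_simps)

lemma hinner_diff_left: "hinner n (\<lambda>i. f i - g i) h = hinner n f h - hinner n g h"
  unfolding hinner_def by (simp add: sum_subtractf algebra_simps)

lemma hinner_diff_right: "hinner n h (\<lambda>i. f i - g i) = hinner n h f - hinner n h g"
  unfolding hinner_def by (simp add: sum_subtractf algebra_simps)

lemma hinner_scale_left: "hinner n (\<lambda>i. c * f i) h = cnj c * hinner n f h"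
  unfolding hinner_def by (simp add: sum_distrib_left mult.assoc)

lemma hinner_scale_right: "hinner n h (\<lambda>i. c * f i) = c * hinner n h f"
  unfolding hinner_def by (simp add: sum_distrib_left algebra_simps)

lemma hinner_sum_left: "hinner n (\<lambda>i. \<Sum>l\<in>L. f l i) h = (\<Sum>l\<in>L. hinner n (f l) h)"
  unfolding hinner_def by (simp add: sum_distrib_right, subst sum.swap, simp)

lemma hinner_sum_right: "hinner n h (\<lambda>i. \<Sum>l\<in>L. f l i) = (\<Sum>l\<in>L. hinner n h (f l))"
  unfolding hinner_def by (simp add: sum_distrib_left, subst sum.swap, simp)

lemmas hinner_linear = hinner_add_left hinner_add_right hinner_diff_left hinner_diff_right
  hinner_scale_left hinner_scale_right

lemma hinner_cong:
  "(\<And>i. i < n \<Longrightarrow> f i = f' i) \<Longrightarrow> (\<And>i. i < n \<Longrightarrow> g i = g' i) \<Longrightarrow> hinner n f g = hinner n f' g'"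
  unfolding hinner_def by (auto intro: sum.cong)

lemma hnorm2_eq_Re: "hnorm2 n f = Re (hinner n f f)"
  by (simp add: hinner_self)

lemma hnorm2_scale: "hnorm2 n (\<lambda>i. c * f i) = (cmod c)\<^sup>2 * hnorm2 n f"
  unfolding hnorm2_def by (simp add: norm_mult power_mult_distrib sum_distrib_left)

text \<open>The index type is arbitrary because the bound serves for coordinates and, in
  \<open>gram2_Cauchy_Schwarz\<close>, for pairs of coordinates.\<close>

lemma Cauchy_Schwarz_sum_complex:
  fixes f g :: "'a \<Rightarrow> complex"
  shows "(cmod (\<Sum>i\<in>I. cnj (f i) * g i))\<^sup>2 \<le> (\<Sum>i\<in>I. (cmod (f i))\<^sup>2) * (\<Sum>i\<in>I. (cmod (g i))\<^sup>2)"
proof -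
  have "cmod (\<Sum>i\<in>I. cnj (f i) * g i) \<le> (\<Sum>i\<in>I. \<bar>cmod (f i)\<bar> * \<bar>cmod (g i)\<bar>)"
    by (rule order_trans[OF norm_sum]) (simp add: norm_mult)
  also have "\<dots> \<le> L2_set (\<lambda>i. cmod (f i)) I * L2_set (\<lambda>i. cmod (g i)) I"
    by (rule L2_set_mult_ineq)
  finally have "(cmod (\<Sum>i\<in>I. cnj (f i) * g i))\<^sup>2
      \<le> (L2_set (\<lambda>i. cmod (f i)) I * L2_set (\<lambda>i. cmod (g i)) I)\<^sup>2"
    by (intro power_mono) auto
  then show ?thesis
    by (simp add: L2_set_def power_mult_distrib sum_nonneg)
qed

lemma hinner_Cauchy_Schwarz: "(cmod (hinner n f g))\<^sup>2 \<le> hnorm2 n f * hnorm2 n g"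
  unfolding hinner_def hnorm2_def by (rule Cauchy_Schwarz_sum_complex)

text \<open>Binet--Cauchy: both sides are the inner product of \<open>x \<and> a\<close> and \<open>b \<and> y\<close>.\<close>

lemma Binet_Cauchy_hinner:
  "(\<Sum>(i, k)\<in>{..<n} \<times> {..<n}. cnj (x i * a k - a i * x k) * (b i * y k - y i * b k))
    = 2 * (hinner n x b * hinner n a y - hinner n x y * hinner n a b)"
proof -
  have eq: "(\<Sum>(i, k)\<in>{..<n} \<times> {..<n}. (cnj (f i) * g i) * (cnj (f' k) * g' k))
      = hinner n f g * hinner n f' g'" for f g f' g'
    by (simp add: hinner_def sum_product sum.cartesian_product)
  have "(\<Sum>(i, k)\<in>{..<n} \<times> {..<n}. cnj (x i * a k - a i * x k) * (b i * y k - y i * b k))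
    = (\<Sum>(i, k)\<in>{..<n} \<times> {..<n}. (cnj (x i) * b i) * (cnj (a k) * y k)
        - (cnj (x i) * y i) * (cnj (a k) * b k) - (cnj (a i) * b i) * (cnj (x k) * y k)
        + (cnj (a i) * y i) * (cnj (x k) * b k))"
    by (rule sum.cong) (auto simp: algebra_simps)
  also have "\<dots> = hinner n x b * hinner n a y - hinner n x y * hinner n a b
      - hinner n a b * hinner n x y + hinner n a y * hinner n x b"
    by (simp add: case_prod_unfold sum.distrib sum_subtractf eq[unfolded case_prod_unfold])
  finally show ?thesis by simp
qed

text \<open>Lagrange's identity, the case \<open>b = x\<close>, \<open>y = a\<close> of
  \<open>Binet_Cauchy_hinner\<close>. The factor 2 appears because ordered pairs of indices count
  every coordinate of the exterior product twice.\<close>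

lemma gram2_eq_sum:
  "2 * gram2 n x a = (\<Sum>(i, k)\<in>{..<n} \<times> {..<n}. (cmod (x i * a k - a i * x k))\<^sup>2)"
proof -
  have "complex_of_real (\<Sum>(i, k)\<in>{..<n} \<times> {..<n}. (cmod (x i * a k - a i * x k))\<^sup>2)
      = (\<Sum>(i, k)\<in>{..<n} \<times> {..<n}. cnj (x i * a k - a i * x k) * (x i * a k - a i * x k))"
    unfolding of_real_sum case_prod_unfold
    by (rule sum.cong) (simp_all only: complex_norm_square mult.commute)
  also have "\<dots> = 2 * (hinner n x x * hinner n a a - hinner n x a * hinner n a x)"
    by (rule Binet_Cauchy_hinner)
  also have "hinner n x a * hinner n a x = of_real ((cmod (hinner n x a))\<^sup>2)"
    by (simp add: complex_norm_square cnj_hinner del: of_real_power)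
  finally have "complex_of_real (\<Sum>(i, k)\<in>{..<n} \<times> {..<n}. (cmod (x i * a k - a i * x k))\<^sup>2)
      = of_real (2 * gram2 n x a)"
    by (simp add: hinner_self gram2_def)
  then show ?thesis by (simp only: of_real_eq_iff)
qed

lemma gram2_nonneg: "0 \<le> gram2 n f g"
  using hinner_Cauchy_Schwarz[of n f g] by (simp add: gram2_def)

text \<open>Cauchy-Schwarz for the exterior products of \<open>x\<close>, \<open>a\<close> and of
  \<open>b\<close>, \<open>y\<close>, taken over ordered pairs of indices; the factors 2
  cancel.\<close>

lemma gram2_Cauchy_Schwarz:
  "(cmod (hinner n x b * hinner n a y - hinner n x y * hinner n a b))\<^sup>2 \<le> gram2 n x a * gram2 n b y"
proof -
  have "(cmod (2 * (hinner n x b * hinner n a y - hinner n x y * hinner n a b)))\<^sup>2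
      \<le> (2 * gram2 n x a) * (2 * gram2 n b y)"
    using Cauchy_Schwarz_sum_complex[of "\<lambda>(i,k). x i * a k - a i * x k"
        "\<lambda>(i,k). b i * y k - y i * b k" "{..<n} \<times> {..<n}"]
    unfolding gram2_eq_sum Binet_Cauchy_hinner[symmetric] by (simp add: case_prod_unfold)
  then show ?thesis unfolding norm_mult power_mult_distrib by simp
qed

section \<open>Nonnegativity of the rank-one form by means of Gram determinants\<close>

lemma two_mult_le_add:
  fixes z p q :: real
  assumes "z\<^sup>2 \<le> p * q" "0 \<le> p" "0 \<le> q"
  shows "2 * z \<le> p + q"
proof (rule power2_le_imp_le)
  have "(2 * z)\<^sup>2 \<le> 4 * (p * q)" using assms(1) by (simp add: power_mult_distrib)
  also have "\<dots> \<le> (p + q)\<^sup>2" using zero_le_power2[of "p - q"] by (simp add: power2_eq_square algebra_simps)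
  finally show "(2 * z)\<^sup>2 \<le> (p + q)\<^sup>2" .
qed (use assms in simp)

text \<open>In the next three lemmas \<open>w\<close> and \<open>y\<close> are images under \<open>B\<^sup>*\<close> of the vectors of the same name
  above, \<open>x = rw\<close>, \<open>S = \<sigma>\<^sub>1(B)\<^sup>2\<close> and \<open>Y\<close> is the squared norm of the original \<open>y\<close>. The summands
  with \<open>hinner n a b - hinner n b a\<close> and \<open>hnorm2 n b - hnorm2 n a\<close> are the added multiples
  of \<open>Im tr X\<close> and \<open>Re tr X\<close>.\<close>

lemma cross_term_bound:
  assumes r: "0 \<le> r" and PQ: "r\<^sup>2 * (gram2 n w a * gram2 n b y) \<le> P * Q" "0 \<le> P" "0 \<le> Q"
  shows "- (r\<^sup>2 * gram2 n w b + gram2 n a y + P + Q)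
    \<le> 2 * r * Re (hinner n w a * hinner n b y - hinner n w b * hinner n a y)
      + 2 * r * Re (hinner n w y * (hinner n a b - hinner n b a))"
proof -
  let ?D1 = "hinner n w b * hinner n a y - hinner n w y * hinner n a b"
  let ?D2 = "hinner n w a * hinner n b y - hinner n w y * hinner n b a"
  have 2: "2 * (r * cmod ?D2) \<le> r\<^sup>2 * gram2 n w b + gram2 n a y"
  proof (rule two_mult_le_add)
    show "(r * cmod ?D2)\<^sup>2 \<le> r\<^sup>2 * gram2 n w b * gram2 n a y"
      using mult_left_mono[OF gram2_Cauchy_Schwarz[of n w a b y], of "r\<^sup>2"]
      by (simp add: power_mult_distrib mult.assoc)
  qed (simp_all add: gram2_nonneg)
  \<comment> \<open>The split into \<open>P\<close> and \<open>Q\<close> is left open because the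
    two applications differ: in general \<open>gram2 n b y\<close> is replaced by a product of
    squared norms, whereas in the collinear case it is computed exactly.\<close>
  have 1: "2 * (r * cmod ?D1) \<le> P + Q"
  proof (rule two_mult_le_add[OF _ PQ(2,3)])
    have "r\<^sup>2 * (cmod ?D1)\<^sup>2 \<le> r\<^sup>2 * (gram2 n w a * gram2 n b y)"
      by (rule mult_left_mono[OF gram2_Cauchy_Schwarz]) simp
    then show "(r * cmod ?D1)\<^sup>2 \<le> P * Q"
      using PQ(1) by (simp add: power_mult_distrib)
  qed
  define R1 where "R1 = Re (hinner n w a * hinner n b y - hinner n w b * hinner n a y)"
  define R2 where "R2 = Re (hinner n w y * (hinner n a b - hinner n b a))"
  \<comment> \<open>The added trace term supplies exactly what completes the cross terms to a
    difference of two inner products of exterior products.\<close>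
  have D: "hinner n w a * hinner n b y - hinner n w b * hinner n a y
      + hinner n w y * (hinner n a b - hinner n b a) = ?D2 - ?D1"
    by (simp add: algebra_simps)
  have "R1 + R2 = Re (?D2 - ?D1)"
    unfolding D[symmetric] R1_def R2_def by simp
  moreover have "Re (?D2 - ?D1) \<ge> - cmod ?D2 - cmod ?D1"
    using complex_Re_le_cmod[of ?D1] abs_Re_le_cmod[of ?D2] unfolding minus_complex.simps by linarith
  ultimately have "R1 + R2 \<ge> - cmod ?D2 - cmod ?D1" by simp
  from mult_left_mono[OF this, of "2 * r"] r
  have "2 * r * R1 + 2 * r * R2 \<ge> - (2 * (r * cmod ?D2)) - 2 * (r * cmod ?D1)"
    by (simp add: algebra_simps)
  with 1 2 show ?thesis unfolding R1_def[symmetric] R2_def[symmetric] by simp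
qed

lemma gram_form_nonneg:
  fixes n :: nat and a b w y :: "nat \<Rightarrow> complex" and \<alpha> S Y r :: real
  assumes w: "hnorm2 n w \<le> S" and y: "hnorm2 n y \<le> S * Y" and r: "0 \<le> r" and Y: "0 \<le> Y"
    and \<alpha>: "3 / 2 * S \<le> \<alpha>"
  shows "0 \<le> 2 * \<alpha> * (hnorm2 n b * r\<^sup>2 + hnorm2 n a * Y) - 2 * r\<^sup>2 * (cmod (hinner n w b))\<^sup>2
     - ((cmod (hinner n w a))\<^sup>2 + (cmod (hinner n w b))\<^sup>2) * Y
     - (cmod (hinner n y a))\<^sup>2 + (cmod (hinner n y b))\<^sup>2
     + 2 * r * Re (hinner n w a * hinner n b y - hinner n w b * hinner n a y)
     + 2 * r * Re (hinner n w y * (hinner n a b - hinner n b a))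
     + S * (hnorm2 n b - hnorm2 n a) * Y"
proof -
  let ?wa = "(cmod (hinner n w a))\<^sup>2" and ?wb = "(cmod (hinner n w b))\<^sup>2"
  let ?ya = "(cmod (hinner n y a))\<^sup>2" and ?yb = "(cmod (hinner n y b))\<^sup>2"
  let ?na = "hnorm2 n a" and ?nb = "hnorm2 n b"
  have S: "0 \<le> S" using w hnorm2_nonneg[of n w] by linarith
  have gwa: "gram2 n w a \<le> S * ?na - ?wa" and gwb: "gram2 n w b \<le> S * ?nb - ?wb"
    unfolding gram2_def using w by (simp_all add: mult_right_mono)
  have gay: "gram2 n a y \<le> ?na * (S * Y) - ?ya"
    unfolding gram2_def cmod_hinner_commute[of n a y] using y by (simp add: mult_left_mono)
  have gby: "gram2 n b y \<le> ?nb * (S * Y)"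
    unfolding gram2_def using y by (simp add: mult_left_mono add_increasing2 diff_le_eq)
  define R1 where "R1 = Re (hinner n w a * hinner n b y - hinner n w b * hinner n a y)"
  define R2 where "R2 = Re (hinner n w y * (hinner n a b - hinner n b a))"
  have "r\<^sup>2 * (gram2 n w a * gram2 n b y) \<le> r\<^sup>2 * (gram2 n w a * (?nb * (S * Y)))"
    by (intro mult_left_mono gby gram2_nonneg) simp
  then have "r\<^sup>2 * (gram2 n w a * gram2 n b y) \<le> (gram2 n w a * Y) * (r\<^sup>2 * (S * ?nb))"
    by (simp add: algebra_simps)
  from cross_term_bound[OF r this]
  have "- (r\<^sup>2 * gram2 n w b + gram2 n a y + gram2 n w a * Y + r\<^sup>2 * (S * ?nb)) \<le> 2 * r * R1 + 2 * r * R2"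
    unfolding R1_def R2_def by (simp add: gram2_nonneg S Y)
  moreover have "r\<^sup>2 * gram2 n w b \<le> r\<^sup>2 * (S * ?nb - ?wb)"
    by (rule mult_left_mono[OF gwb]) simp
  moreover have "gram2 n w a * Y \<le> (S * ?na - ?wa) * Y"
    by (rule mult_right_mono[OF gwa Y])
  \<comment> \<open>This is where 3/2 comes from. In the coefficient of
    \<open>hnorm2 n a * Y\<close> the three copies of \<open>S\<close> are used up by
    \<open>gay\<close>, by \<open>gwa\<close> and by the added trace term. What remains in total is
    (\<open>S * hnorm2 n b\<close> - |<w,b>|^2)(r^2 + Y) + |<y,b>|^2.\<close>
  moreover have "(3 * S) * (?nb * r\<^sup>2 + ?na * Y) \<le> 2 * \<alpha> * (?nb * r\<^sup>2 + ?na * Y)"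
    by (rule mult_right_mono) (use \<alpha> Y in simp_all)
  moreover have "0 \<le> r\<^sup>2 * (S * ?nb - ?wb)"
    by (rule mult_nonneg_nonneg) (use gwb gram2_nonneg[of n w b] in simp_all)
  moreover have "0 \<le> (S * ?nb - ?wb) * Y"
    by (rule mult_nonneg_nonneg) (use gwb gram2_nonneg[of n w b] Y in simp_all)
  moreover define yb2 where "yb2 = ?yb"
  moreover have "0 \<le> yb2" unfolding yb2_def by simp
  ultimately show ?thesis
    using gay unfolding yb2_def[symmetric] R1_def[symmetric] R2_def[symmetric]
    by (simp add: algebra_simps)
qed

lemma gram_form_nonneg_collinear:
  fixes n :: nat and a b w y :: "nat \<Rightarrow> complex" and \<alpha> S r :: real and \<eta> :: complex
  assumes w: "hnorm2 n w \<le> S" and y: "y = (\<lambda>i. \<eta> * w i)" and r: "0 \<le> r"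
    and \<alpha>: "S \<le> \<alpha>"
  shows "0 \<le> 2 * \<alpha> * (hnorm2 n b * r\<^sup>2 + hnorm2 n a * (cmod \<eta>)\<^sup>2) - 2 * r\<^sup>2 * (cmod (hinner n w b))\<^sup>2
     - ((cmod (hinner n w a))\<^sup>2 + (cmod (hinner n w b))\<^sup>2) * (cmod \<eta>)\<^sup>2
     - (cmod (hinner n y a))\<^sup>2 + (cmod (hinner n y b))\<^sup>2
     + 2 * r * Re (hinner n w a * hinner n b y - hinner n w b * hinner n a y)
     + 2 * r * Re (hinner n w y * (hinner n a b - hinner n b a))"
proof -
  let ?Y = "(cmod \<eta>)\<^sup>2"
  let ?wa = "(cmod (hinner n w a))\<^sup>2" and ?wb = "(cmod (hinner n w b))\<^sup>2"
  let ?na = "hnorm2 n a" and ?nb = "hnorm2 n b"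
  have ya: "(cmod (hinner n y a))\<^sup>2 = ?Y * ?wa" "(cmod (hinner n y b))\<^sup>2 = ?Y * ?wb"
    by (simp_all add: y hinner_scale_left norm_mult power_mult_distrib)
  have g: "gram2 n c y = ?Y * gram2 n w c" for c
    by (simp add: gram2_def y hnorm2_scale hinner_scale_right norm_mult power_mult_distrib
        cmod_hinner_commute[of n c w] algebra_simps)
  have gwa: "gram2 n w a \<le> S * ?na - ?wa" and gwb: "gram2 n w b \<le> S * ?nb - ?wb"
    unfolding gram2_def using w by (simp_all add: mult_right_mono)
  define R1 where "R1 = Re (hinner n w a * hinner n b y - hinner n w b * hinner n a y)"
  define R2 where "R2 = Re (hinner n w y * (hinner n a b - hinner n b a))"
  have "r\<^sup>2 * (gram2 n w a * gram2 n b y) \<le> (gram2 n w a * ?Y) * (r\<^sup>2 * gram2 n w b)"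
    by (simp add: g algebra_simps)
  from cross_term_bound[OF r this]
  have "- (2 * (r\<^sup>2 * gram2 n w b) + 2 * (?Y * gram2 n w a)) \<le> 2 * r * R1 + 2 * r * R2"
    unfolding R1_def R2_def g by (simp add: gram2_nonneg mult.commute)
  moreover have "r\<^sup>2 * gram2 n w b \<le> r\<^sup>2 * (S * ?nb - ?wb)"
    by (rule mult_left_mono[OF gwb]) simp
  moreover have "?Y * gram2 n w a \<le> ?Y * (S * ?na - ?wa)"
    by (rule mult_left_mono[OF gwa]) simp
  \<comment> \<open>By collinearity both estimates of exterior products cost the same Gram
    determinants, and with \<open>2 * S\<close> all terms cancel exactly.\<close>
  moreover have "(2 * S) * (?nb * r\<^sup>2 + ?na * ?Y) \<le> 2 * \<alpha> * (?nb * r\<^sup>2 + ?na * ?Y)"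
    by (rule mult_right_mono) (use \<alpha> in simp_all)
  ultimately show ?thesis
    unfolding ya R1_def[symmetric] R2_def[symmetric] by (simp add: algebra_simps)
qed

subsection \<open>Diagonalization of Hermitian matrices\<close>

lemma mat_adjoint_carrier [simp]: "A \<in> carrier_mat m n \<Longrightarrow> mat_adjoint A \<in> carrier_mat n m"
  by (intro carrier_matI) auto

lemma mat_adjoint_adjoint [simp]: "mat_adjoint (mat_adjoint A) = (A :: complex mat)"
  by (rule eq_matI) auto

lemma index_mult_mat_sum:
  "i < dim_row A \<Longrightarrow> j < dim_col B \<Longrightarrow> dim_col A = dim_row B \<Longrightarrow>
    (A * B) $$ (i, j) = (\<Sum>k<dim_row B. A $$ (i, k) * B $$ (k, j))"
  by (simp add: scalar_prod_def atLeast0LessThan)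

lemma mat_adjoint_mult:
  assumes "A \<in> carrier_mat m n" "B \<in> carrier_mat n k"
  shows "mat_adjoint (A * B) = mat_adjoint B * mat_adjoint (A :: complex mat)"
  using assms
  by (intro eq_matI) (auto simp: index_mult_mat_sum mult.commute simp del: index_mult_mat(1))

text \<open>Complete \<open>v\<close> to a basis and apply Gram-Schmidt, which keeps the first
  vector but yields only orthogonality. The columns of \<open>W\<close> are the normalized results;
  \<open>v\<close> has length 1 and is unchanged by this.\<close>

lemma unitary_completion:
  assumes v: "v \<in> carrier_vec n" and v0: "v \<bullet>c v = (1::complex)"
  shows "\<exists>W\<in>carrier_mat n n. mat_adjoint W * W = 1\<^sub>m n \<and> col W 0 = v"
proof -
  have vn0: "v \<noteq> 0\<^sub>v n" using v0 v by auto
  then have n: "n \<noteq> 0" using v by auto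
  interpret cof_vec_space n "TYPE(complex)" .
  define b where "b = basis_completion v"
  define ws where "ws = gram_schmidt n b"
  note bc = basis_completion[OF v vn0, folded b_def]
  from bc(6,7) n obtain vs where bv: "b = v # vs" by (cases b) auto
  from gram_schmidt_result[OF bc(2,4,5) refl, folded ws_def]
  have ws: "set ws \<subseteq> carrier_vec n" "corthogonal ws" "length ws = n"
    by (auto simp: bc(6))
  from gram_schmidt_hd[OF v, of vs, folded bv] have hdws: "hd ws = v" unfolding ws_def .
  have ws0: "ws ! 0 = v" using hdws n ws(3) by (metis hd_conv_nth list.size(3))
  have wsc: "ws ! i \<in> carrier_vec n" if "i < n" for i using ws that by auto
  define s where "s i = sqrt (Re (ws ! i \<bullet>c ws ! i))" for i
  have s: "of_real (s i) * of_real (s i) = ws ! i \<bullet>c ws ! i" "s i \<noteq> 0" if "i < n" for i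
  proof -
    have ge: "0 \<le> ws ! i \<bullet>c ws ! i" by (rule conjugate_square_ge_0_vec)
    have ne: "ws ! i \<bullet>c ws ! i \<noteq> 0" using corthogonalD[OF ws(2), of i i] that ws(3) by auto
    from ge have "Im (ws ! i \<bullet>c ws ! i) = 0" "Re (ws ! i \<bullet>c ws ! i) \<ge> 0"
      by (auto simp: less_eq_complex_def)
    then show "of_real (s i) * of_real (s i) = ws ! i \<bullet>c ws ! i"
      unfolding s_def by (simp add: complex_eq_iff flip: of_real_mult)
    with ne show "s i \<noteq> 0" by auto
  qed
  define W where "W = mat n n (\<lambda>(i,j). ws ! j $ i / of_real (s j))"
  have W: "W \<in> carrier_mat n n" unfolding W_def by simp
  have "mat_adjoint W * W = 1\<^sub>m n"
  proof (rule eq_matI)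
    fix i j assume "i < dim_row (1\<^sub>m n :: complex mat)" "j < dim_col (1\<^sub>m n :: complex mat)"
    then have i: "i < n" and j: "j < n" by auto
    have "(mat_adjoint W * W) $$ (i, j) = (\<Sum>k<n. cnj (ws ! i $ k / of_real (s i)) * (ws ! j $ k / of_real (s j)))"
      using i j W by (subst index_mult_mat_sum) (auto simp: W_def intro!: sum.cong)
    also have "\<dots> = (ws ! j \<bullet>c ws ! i) / (of_real (s i) * of_real (s j))"
      using wsc[OF i] wsc[OF j]
      by (simp add: scalar_prod_def sum_divide_distrib atLeast0LessThan mult.commute)
    also have "\<dots> = (if i = j then 1 else 0)"
      using corthogonalD[OF ws(2), of j i] i j ws(3) s[OF i] by auto
    finally show "(mat_adjoint W * W) $$ (i, j) = 1\<^sub>m n $$ (i, j)" using i j by simp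
  qed (use W in auto)
  moreover have "col W 0 = v"
  proof (rule eq_vecI)
    fix i assume "i < dim_vec v"
    moreover have "s 0 = 1" unfolding s_def ws0 v0 by simp
    ultimately show "col W 0 $ i = v $ i" using n v ws0 by (simp add: W_def)
  qed (use W v in auto)
  ultimately show ?thesis using W by blast
qed

text \<open>Induction on the list of roots: a unit eigenvector is completed to a unitary matrix, and
  conjugation by it splits off a 1 by 1 block. The list \<open>es\<close> may have any order, so the
  eigenvalues can later be arranged to match decreasing singular values.\<close>

lemma hermitian_diagonalization:
  fixes A :: "complex mat"
  assumes "A \<in> carrier_mat n n" "mat_adjoint A = A" "char_poly A = (\<Prod>e\<leftarrow>es. [:- e, 1:])"
  shows "\<exists>U\<in>carrier_mat n n. mat_adjoint U * U = 1\<^sub>m n \<and> A * U = U * mat_diag n (\<lambda>i. es ! i)"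
  using assms
proof (induction es arbitrary: n A)
  case Nil
  then have "n = 0" using degree_monic_char_poly[of A n] by auto
  with Nil show ?case by (intro bexI[of _ "1\<^sub>m 0"] conjI eq_matI) (auto simp: mat_diag_def)
next
  case (Cons e es)
  note A = Cons.prems(1) and herm = Cons.prems(2)
  have e: "eigenvalue A e"
    unfolding eigenvalue_root_char_poly[OF A] Cons.prems(3) by simp
  then obtain x where x: "x \<in> carrier_vec n" "x \<noteq> 0\<^sub>v n" "A *\<^sub>v x = e \<cdot>\<^sub>v x"
    using A unfolding eigenvalue_def eigenvector_def by auto
  obtain n1 where n1: "n = Suc n1" using x(1,2) by (cases n) auto
  define c where "c = sqrt (Re (x \<bullet>c x))"
  have ge: "0 \<le> x \<bullet>c x" by (rule conjugate_square_ge_0_vec)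
  have ne: "x \<bullet>c x \<noteq> 0" using conjugate_square_eq_0_vec[OF x(1)] x(2) by auto
  from ge have "Im (x \<bullet>c x) = 0" "Re (x \<bullet>c x) \<ge> 0"
    by (auto simp: less_eq_complex_def)
  then have c: "of_real c * of_real c = x \<bullet>c x"
    unfolding c_def by (simp add: complex_eq_iff flip: of_real_mult)
  with ne have c0: "c \<noteq> 0" by auto
  define v where "v = (1 / of_real c) \<cdot>\<^sub>v x"
  have v: "v \<in> carrier_vec n" unfolding v_def using x by simp
  have "v \<bullet>c v = (1 / of_real c) * cnj (1 / of_real c) * (x \<bullet>c x)"
    unfolding v_def using x(1)
    by (simp add: scalar_prod_def sum_distrib_left sum_divide_distrib mult.commute)
  also have "\<dots> = 1" using c0 unfolding c[symmetric] by simp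
  finally obtain W where W: "W \<in> carrier_mat n n" "mat_adjoint W * W = 1\<^sub>m n" "col W 0 = v"
    using unitary_completion[OF v] by blast
  have Av: "A *\<^sub>v v = e \<cdot>\<^sub>v v"
    unfolding v_def using x A by (simp add: mult_mat_vec smult_smult_assoc mult.commute)
  let ?W' = "mat_adjoint W"
  have W': "?W' \<in> carrier_mat n n" using W(1) by simp
  have WW': "W * ?W' = 1\<^sub>m n" by (rule mat_mult_left_right_inverse[OF W' W(1,2)])
  define A' where "A' = ?W' * A * W"
  have A': "A' \<in> carrier_mat n n" unfolding A'_def using W' A W(1) by auto
  have hermA': "mat_adjoint A' = A'"
    unfolding A'_def using W' A W(1) herm
    by (subst mat_adjoint_mult[of _ n n _ n], auto,
        subst mat_adjoint_mult[of _ n n _ n], auto intro!: assoc_mult_mat[symmetric])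
  have WA': "W * A' = A * W"
  proof -
    have "W * A' = (W * ?W') * (A * W)" unfolding A'_def using W' A W(1)
      by (simp add: assoc_mult_mat[of _ n n _ n _ n])
    then show ?thesis unfolding WW' using A W(1) by simp
  qed
  have col0: "A' $$ (i, 0) = (if i = 0 then e else 0)" if i: "i < n" for i
  proof -
    have "A' $$ (i, 0) = row ?W' i \<bullet> col (A * W) 0"
      unfolding A'_def using W' A W(1) i n1 by (subst assoc_mult_mat[of _ n n _ n _ n]) auto
    also have "col (A * W) 0 = e \<cdot>\<^sub>v col W 0"
      using A W n1 Av by (subst col_mult2) auto
    also have "row ?W' i \<bullet> \<dots> = e * (row ?W' i \<bullet> col W 0)"
      using W W' i by (intro scalar_prod_smult_right) auto
    also have "row ?W' i \<bullet> col W 0 = (?W' * W) $$ (i, 0)"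
      using W W' i n1 by (subst index_mult_mat) auto
    finally show ?thesis unfolding W(2) using i n1 by auto
  qed
  \<comment> \<open>The first column vanishes below the corner because it comes from an eigenvector;
    the first row does so because \<open>A'\<close> is Hermitian.\<close>
  have row0: "A' $$ (0, j) = (if j = 0 then e else 0)" if j: "j < n" for j
  proof (cases "j = 0")
    case False
    have "A' $$ (0, j) = mat_adjoint A' $$ (0, j)" unfolding hermA' ..
    also have "\<dots> = cnj (A' $$ (j, 0))" using A' j n1 by auto
    finally show ?thesis using col0[OF j] False by simp
  qed (use col0 n1 in auto)
  define A1 where "A1 = mat 1 1 (\<lambda>_. e)"
  define A3 where "A3 = mat n1 n1 (\<lambda>(i,j). A' $$ (Suc i, Suc j))"
  have A1: "A1 \<in> carrier_mat 1 1" and A3: "A3 \<in> carrier_mat n1 n1" unfolding A1_def A3_def by auto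
  have A'_block: "A' = four_block_mat A1 (0\<^sub>m 1 n1) (0\<^sub>m n1 1) A3"
    by (rule eq_matI) (use A' n1 in \<open>auto simp: A1_def A3_def col0 row0\<close>)
  have "similar_mat A' A"
    unfolding similar_mat_def similar_mat_wit_def
    by (intro exI[of _ ?W'] exI[of _ W]) (use A A' W W' WW' A'_def in \<open>auto simp: Let_def\<close>)
  then have "char_poly A = char_poly A'" by (simp add: char_poly_similar)
  also have "\<dots> = char_poly A1 * char_poly A3"
    unfolding A'_block by (rule char_poly_four_block_zeros_col[OF A1 _ A3]) simp
  also have "char_poly A1 = [:- e, 1:]"
    unfolding A1_def char_poly_def by (simp add: char_poly_matrix_def det_def)
  \<comment> \<open>Cancelling the linear factor of \<open>e\<close> leaves the remaining roots, in
    their given order, for the smaller block.\<close>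
  finally have "[:- e, 1:] * char_poly A3 = [:- e, 1:] * (\<Prod>e\<leftarrow>es. [:- e, 1:])"
    unfolding Cons.prems(3) by (simp only: list.map prod_list.Cons)
  then have cp3: "char_poly A3 = (\<Prod>e\<leftarrow>es. [:- e, 1:])"
    by (subst (asm) mult_left_cancel) simp_all
  have "mat_adjoint A3 = A3"
  proof (rule eq_matI)
    fix i j assume "i < dim_row A3" "j < dim_col A3"
    then have ij: "i < n1" "j < n1" using A3 by auto
    have "A' $$ (Suc i, Suc j) = mat_adjoint A' $$ (Suc i, Suc j)" unfolding hermA' ..
    also have "\<dots> = cnj (A' $$ (Suc j, Suc i))" using A' ij n1 by auto
    finally show "mat_adjoint A3 $$ (i, j) = A3 $$ (i, j)"
      using ij by (simp add: A3_def)
  qed (use A3 in auto)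
  from Cons.IH[OF A3 this cp3] obtain U where U: "U \<in> carrier_mat n1 n1"
    "mat_adjoint U * U = 1\<^sub>m n1" "A3 * U = U * mat_diag n1 (\<lambda>i. es ! i)" by blast
  \<comment> \<open>The unitary matrix for the smaller block, extended by 1 in the corner;
    \<open>W * F\<close> then diagonalizes \<open>A\<close>.\<close>
  define F where "F = four_block_mat (1\<^sub>m 1) (0\<^sub>m 1 n1) (0\<^sub>m n1 1) U"
  have F: "F \<in> carrier_mat n n" unfolding F_def n1 using U by auto
  have F': "mat_adjoint F = four_block_mat (1\<^sub>m 1) (0\<^sub>m 1 n1) (0\<^sub>m n1 1) (mat_adjoint U)"
    by (rule eq_matI) (use U in \<open>auto simp: F_def\<close>)
  have FF: "mat_adjoint F * F = 1\<^sub>m n"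
    unfolding F' unfolding F_def
    by (subst mult_four_block_mat[of _ 1 1 _ n1 _ n1 _ _ 1 _ n1])
       (use U in \<open>auto simp: n1 four_block_one_mat\<close>)
  have D: "mat_diag n (\<lambda>i. (e # es) ! i)
      = four_block_mat A1 (0\<^sub>m 1 n1) (0\<^sub>m n1 1) (mat_diag n1 (\<lambda>i. es ! i))"
    by (rule eq_matI) (auto simp: n1 A1_def mat_diag_def)
  have D': "mat_diag n1 (\<lambda>i. es ! i) \<in> carrier_mat n1 n1" by (simp add: mat_diag_def)
  have z: "0\<^sub>m 1 n1 \<in> carrier_mat 1 n1" and z': "0\<^sub>m n1 1 \<in> carrier_mat n1 1"
    and o: "1\<^sub>m 1 \<in> carrier_mat 1 1" by auto
  have AF: "A' * F = F * mat_diag n (\<lambda>i. (e # es) ! i)"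
    unfolding D A'_block F_def
    by (subst mult_four_block_mat[OF A1 z z' A3 o z z' U(1)],
        subst mult_four_block_mat[OF o z z' U(1) A1 z z' D'])
       (use U A1 A3 in \<open>auto simp: left_mult_zero_mat[OF D']\<close>)
  let ?D = "mat_diag n (\<lambda>i. (e # es) ! i)"
  have Dc: "?D \<in> carrier_mat n n" by (simp add: mat_diag_def)
  show ?case
  proof (intro bexI[of _ "W * F"] conjI)
    show WF: "W * F \<in> carrier_mat n n" using W F by auto
    have "mat_adjoint (W * F) * (W * F) = mat_adjoint F * ((?W' * W) * F)"
      unfolding mat_adjoint_mult[OF W(1) F] using F WF
      by (simp only: assoc_mult_mat[OF mat_adjoint_carrier[OF F] W' WF] assoc_mult_mat[OF W' W(1) F])
    also have "\<dots> = 1\<^sub>m n" unfolding W(2) using F FF by simp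
    finally show "mat_adjoint (W * F) * (W * F) = 1\<^sub>m n" .
    have "A * (W * F) = (W * A') * F" unfolding WA' using A W F by (simp add: assoc_mult_mat[of _ n n _ n _ n])
    also have "\<dots> = W * (F * ?D)" unfolding AF[symmetric] using W A' F
      by (simp add: assoc_mult_mat[of _ n n _ n _ n])
    also have "\<dots> = W * F * ?D" using W F Dc by (simp add: assoc_mult_mat[of _ n n _ n _ n])
    finally show "A * (W * F) = W * F * ?D" .
  qed
qed

subsection \<open>Singular vectors\<close>

text \<open>Multiplication by a matrix for vectors encoded as functions. Only values at indices
  below the number of rows are meaningful.\<close>

definition mat_app :: "complex mat \<Rightarrow> (nat \<Rightarrow> complex) \<Rightarrow> nat \<Rightarrow> complex" where
  "mat_app M f i = (\<Sum>k<dim_col M. M $$ (i, k) * f k)"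

lemma mat_app_cong: "(\<And>k. k < dim_col M \<Longrightarrow> f k = g k) \<Longrightarrow> mat_app M f = mat_app M g"
  unfolding mat_app_def by (auto intro: sum.cong)

lemma mat_app_add: "mat_app M (\<lambda>k. f k + g k) = (\<lambda>i. mat_app M f i + mat_app M g i)"
  unfolding mat_app_def by (simp add: sum.distrib algebra_simps)

lemma mat_app_diff: "mat_app M (\<lambda>k. f k - g k) = (\<lambda>i. mat_app M f i - mat_app M g i)"
  unfolding mat_app_def by (simp add: sum_subtractf algebra_simps)

lemma mat_app_scale: "mat_app M (\<lambda>k. c * f k) = (\<lambda>i. c * mat_app M f i)"
  unfolding mat_app_def by (simp add: sum_distrib_left algebra_simps)

lemma mat_app_sum: "mat_app M (\<lambda>k. \<Sum>l\<in>L. f l k) = (\<lambda>i. \<Sum>l\<in>L. mat_app M (f l) i)"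
  unfolding mat_app_def by (simp add: sum_distrib_left, subst sum.swap, simp)

lemma mat_app_mult:
  assumes "A \<in> carrier_mat m n" "B \<in> carrier_mat n k" "i < m"
  shows "mat_app (A * B) f i = mat_app A (mat_app B f) i"
proof -
  have "mat_app (A * B) f i = (\<Sum>l<k. (\<Sum>j<n. A $$ (i, j) * B $$ (j, l)) * f l)"
    using assms unfolding mat_app_def
    by (auto simp: index_mult_mat_sum simp del: index_mult_mat(1) intro!: sum.cong)
  also have "\<dots> = (\<Sum>j<n. \<Sum>l<k. A $$ (i, j) * (B $$ (j, l) * f l))"
    by (simp add: sum_distrib_right mult.assoc, rule sum.swap)
  also have "\<dots> = mat_app A (mat_app B f) i"
    using assms unfolding mat_app_def by (simp add: sum_distrib_left)
  finally show ?thesis .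
qed

lemma hinner_mat_app_adjoint:
  assumes "Z \<in> carrier_mat m n"
  shows "hinner m f (mat_app Z g) = hinner n (mat_app (mat_adjoint Z) f) g"
proof -
  have "hinner m f (mat_app Z g) = (\<Sum>i<m. \<Sum>k<n. cnj (f i) * (Z $$ (i, k) * g k))"
    using assms unfolding hinner_def mat_app_def by (simp add: sum_distrib_left)
  also have "\<dots> = (\<Sum>k<n. \<Sum>i<m. cnj (f i) * (Z $$ (i, k) * g k))" by (rule sum.swap)
  also have "\<dots> = hinner n (mat_app (mat_adjoint Z) f) g"
    using assms unfolding hinner_def mat_app_def
    by (auto simp: sum_distrib_right sum_distrib_left algebra_simps intro!: sum.cong)
  finally show ?thesis .
qed

lemma hinner_orthogonal_sum:
  fixes N :: nat
  assumes "\<And>i k. i < N \<Longrightarrow> k < N \<Longrightarrow> hinner n (W i) (W k) = (if i = k then of_real (d i) else 0)"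
  shows "hinner n (\<lambda>x. \<Sum>i<N. a i * W i x) (\<lambda>x. \<Sum>i<N. b i * W i x)
    = (\<Sum>i<N. cnj (a i) * b i * of_real (d i))"
proof -
  have "hinner n (\<lambda>x. \<Sum>i<N. a i * W i x) (\<lambda>x. \<Sum>i<N. b i * W i x)
    = (\<Sum>i<N. \<Sum>k<N. cnj (a i) * b k * hinner n (W i) (W k))"
    by (simp add: hinner_sum_left hinner_sum_right hinner_scale_left hinner_scale_right sum_distrib_left mult.assoc)
  also have "\<dots> = (\<Sum>i<N. \<Sum>k<N. if k = i then cnj (a i) * b i * of_real (d i) else 0)"
    by (intro sum.cong refl) (auto simp: assms)
  also have "\<dots> = (\<Sum>i<N. cnj (a i) * b i * of_real (d i))"
    by (intro sum.cong refl, subst sum.delta) auto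
  finally show ?thesis .
qed

text \<open>The weights \<open>d\<close> cover both orthonormal families, with
  \<open>d i = 1\<close>, and images of singular vectors, with squared singular values.\<close>

lemma hnorm2_orthogonal_sum:
  fixes N :: nat
  assumes "\<And>i k. i < N \<Longrightarrow> k < N \<Longrightarrow> hinner n (W i) (W k) = (if i = k then of_real (d i) else 0)"
  shows "hnorm2 n (\<lambda>x. \<Sum>i<N. a i * W i x) = (\<Sum>i<N. (cmod (a i))\<^sup>2 * d i)"
proof -
  have "complex_of_real (hnorm2 n (\<lambda>x. \<Sum>i<N. a i * W i x)) = (\<Sum>i<N. cnj (a i) * a i * of_real (d i))"
    unfolding hinner_self[symmetric] by (rule hinner_orthogonal_sum[OF assms])
  also have "\<dots> = of_real (\<Sum>i<N. (cmod (a i))\<^sup>2 * d i)"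
    unfolding of_real_sum of_real_mult complex_norm_square by (simp add: mult.commute)
  finally show ?thesis by (simp only: of_real_eq_iff)
qed

lemma hinner_cols_unitary:
  assumes "U \<in> carrier_mat n n" "mat_adjoint U * U = 1\<^sub>m n" "i < n" "k < n"
  shows "hinner n (\<lambda>x. U $$ (x, i)) (\<lambda>x. U $$ (x, k)) = (if i = k then 1 else 0)"
proof -
  have "hinner n (\<lambda>x. U $$ (x, i)) (\<lambda>x. U $$ (x, k)) = (mat_adjoint U * U) $$ (i, k)"
    using assms(1,3,4) by (subst index_mult_mat_sum) (auto simp: hinner_def)
  then show ?thesis using assms by simp
qed

lemma unitary_expansion:
  assumes U: "U \<in> carrier_mat n n" "mat_adjoint U * U = 1\<^sub>m n" and x: "x < n"
  shows "f x = (\<Sum>i<n. hinner n (\<lambda>x. U $$ (x, i)) f * U $$ (x, i))"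
proof -
  have 1: "U * mat_adjoint U = 1\<^sub>m n"
    by (rule mat_mult_left_right_inverse[OF mat_adjoint_carrier[OF U(1)] U])
  have "(\<Sum>i<n. hinner n (\<lambda>x. U $$ (x, i)) f * U $$ (x, i))
      = (\<Sum>i<n. \<Sum>y<n. (U $$ (x, i) * cnj (U $$ (y, i))) * f y)"
    by (simp add: hinner_def sum_distrib_left algebra_simps)
  also have "\<dots> = (\<Sum>y<n. (\<Sum>i<n. U $$ (x, i) * cnj (U $$ (y, i))) * f y)"
    by (simp add: sum_distrib_right, rule sum.swap)
  also have "\<dots> = (\<Sum>y<n. (U * mat_adjoint U) $$ (x, y) * f y)"
    using U(1) x by (intro sum.cong refl) (subst index_mult_mat_sum, auto)
  also have "\<dots> = (\<Sum>y<n. if y = x then f y else 0)"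
    unfolding 1 using x by (intro sum.cong refl) auto
  also have "\<dots> = f x" using x by simp
  finally show ?thesis ..
qed

text \<open>By the spectral theorem, \<open>z l\<close> can be taken as column \<open>l\<close> of
  the unitary matrix times the square root of its eigenvalue. That eigenvalue is nonnegative, being
  the value of the quadratic form at the column.\<close>

lemma positive_semidefinite_sum_rank_one:
  assumes M: "M \<in> carrier_mat N N" and psd: "positive_semidefinite M"
  shows "\<exists>z. \<forall>i<N. \<forall>j<N. M $$ (i, j) = (\<Sum>l<N. z l i * cnj (z l j))"
proof -
  have herm: "mat_adjoint M = M" using psd unfolding positive_semidefinite_def by blast
  obtain es where es: "char_poly M = (\<Prod>e\<leftarrow>es. [:- e, 1:])"
    using char_poly_factorized[OF M] by blast
  obtain U where U: "U \<in> carrier_mat N N" "mat_adjoint U * U = 1\<^sub>m N"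
    and MU: "M * U = U * mat_diag N (\<lambda>i. es ! i)"
    using hermitian_diagonalization[OF M herm es] by blast
  have UD: "U * mat_diag N (\<lambda>i. es ! i) = mat N N (\<lambda>(i,j). U $$ (i,j) * es ! j)"
    by (rule mat_diag_mult_right[OF U(1)])
  have e0: "0 \<le> es ! l" if l: "l < N" for l
  proof -
    have v: "col U l \<in> carrier_vec N" using U(1) l by auto
    have "M *\<^sub>v col U l = col (M * U) l" using M U(1) l by auto
    also have "\<dots> = es ! l \<cdot>\<^sub>v col U l" unfolding MU UD using l U(1) by (intro eq_vecI) auto
    finally have "(M *\<^sub>v col U l) \<bullet>c col U l = es ! l * (col U l \<bullet>c col U l)"
      using v by simp
    also have "col U l \<bullet>c col U l = hinner N (\<lambda>x. U $$ (x, l)) (\<lambda>x. U $$ (x, l))"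
      using U(1) l by (auto simp: scalar_prod_def hinner_def atLeast0LessThan mult.commute)
    also have "\<dots> = 1" using hinner_cols_unitary[OF U l l] by simp
    finally have "(M *\<^sub>v col U l) \<bullet>c col U l = es ! l" by simp
    then show ?thesis using psd v M unfolding positive_semidefinite_def by (metis carrier_matD(1))
  qed
  have e: "es ! l = of_real (sqrt (Re (es ! l))) * of_real (sqrt (Re (es ! l)))" if "l < N" for l
  proof -
    from e0[OF that] have "Im (es ! l) = 0" "Re (es ! l) \<ge> 0" by (auto simp: less_eq_complex_def)
    then show ?thesis by (simp add: complex_eq_iff flip: of_real_mult)
  qed
  have 1: "U * mat_adjoint U = 1\<^sub>m N"
    by (rule mat_mult_left_right_inverse[OF mat_adjoint_carrier[OF U(1)] U])
  have "M = M * (U * mat_adjoint U)" unfolding 1 using M by simp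
  also have "\<dots> = (M * U) * mat_adjoint U"
    by (rule assoc_mult_mat[symmetric, OF M U(1) mat_adjoint_carrier[OF U(1)]])
  finally have M_eq: "M = mat N N (\<lambda>(i,j). U $$ (i,j) * es ! j) * mat_adjoint U"
    unfolding MU UD .
  define z where "z l i = of_real (sqrt (Re (es ! l))) * U $$ (i, l)" for l i
  have "M $$ (i, j) = (\<Sum>l<N. z l i * cnj (z l j))" if ij: "i < N" "j < N" for i j
  proof -
    have "M $$ (i, j) = (\<Sum>l<N. (U $$ (i, l) * es ! l) * cnj (U $$ (j, l)))"
      by (subst M_eq, subst index_mult_mat_sum) (use U(1) ij in auto)
    also have "\<dots> = (\<Sum>l<N. z l i * cnj (z l j))"
      by (intro sum.cong refl, subst e) (auto simp: z_def)
    finally show ?thesis .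
  qed
  then show ?thesis by blast
qed

section \<open>Singular bases and norm bounds by singular values\<close>

lemma proots_prod_linear: "proots (\<Prod>e\<leftarrow>es. [:- e, 1 :: 'a :: idom:]) = mset es"
proof (induction es)
  case (Cons e es)
  have "(\<Prod>e\<leftarrow>es. [:- e, 1 :: 'a:]) \<noteq> 0" by (auto simp: prod_list_zero_iff)
  then show ?case using Cons by (simp add: proots_mult del: mult_pCons_left)
qed simp

lemma singular_value_antimono:
  assumes "1 \<le> i" "i \<le> j" "j \<le> dim_col Z"
  shows "singular_value Z j \<le> singular_value Z i"
proof -
  have "sorted (rev (singular_values Z))" unfolding singular_values_def by simp
  from sorted_rev_nth_mono[OF this, of "i - 1" "j - 1"] show ?thesis
    using assms unfolding singular_value_def by (simp add: length_singular_values)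
qed

text \<open>The \<open>V i\<close> are orthonormal eigenvectors of Z*Z. Their images are orthogonal
  because the inner products of these images are the entries of U*Z*ZU, which is diagonal. Vectors
  are numbered from 0 and singular values from 1.\<close>

lemma singular_basis:
  assumes Z: "Z \<in> carrier_mat m n"
  obtains V where
    "\<And>i k. i < n \<Longrightarrow> k < n \<Longrightarrow> hinner n (V i) (V k) = (if i = k then 1 else 0)"
    "\<And>i k. i < n \<Longrightarrow> k < n \<Longrightarrow> hinner m (mat_app Z (V i)) (mat_app Z (V k))
        = (if i = k then of_real ((singular_value Z (Suc i))\<^sup>2) else 0)"
    "\<And>f x. x < n \<Longrightarrow> f x = (\<Sum>i<n. hinner n (V i) f * V i x)"
    "\<And>i. i < n \<Longrightarrow> 0 \<le> singular_value Z (Suc i)"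
proof -
  let ?A = "mat_adjoint Z * Z" and ?f = "\<lambda>z. sqrt (Re z)"
  have Z': "mat_adjoint Z \<in> carrier_mat n m" using Z by simp
  have A: "?A \<in> carrier_mat n n" using Z Z' by auto
  have herm: "mat_adjoint ?A = ?A" by (simp add: mat_adjoint_mult[OF Z' Z])
  obtain es0 where es0: "char_poly ?A = (\<Prod>e\<leftarrow>es0. [:- e, 1:])" "length es0 = n"
    using char_poly_factorized[OF A] by blast
  \<comment> \<open>Complex eigenvalues carry no linear order, so they are sorted by the key that
    turns them into singular values.\<close>
  define es where "es = rev (sort_key ?f es0)"
  have mset: "mset es = mset es0" unfolding es_def by simp
  have "prod_mset (image_mset (\<lambda>e. [:- e, 1:]) (mset es)) = prod_mset (image_mset (\<lambda>e. [:- e, 1:]) (mset es0))"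
    unfolding mset ..
  then have es: "char_poly ?A = (\<Prod>e\<leftarrow>es. [:- e, 1:])"
    unfolding es0 by (simp only: prod_mset_prod_list mset_map[symmetric])
  have len: "length es = n" using mset es0(2) by (metis size_mset)
  have "sorted_list_of_multiset (image_mset ?f (mset es0)) = sort (map ?f es0)"
    by (simp flip: mset_map)
  also have "\<dots> = map ?f (sort_key ?f es0)"
    by (rule properties_for_sort) simp_all
  finally have sv_list: "singular_values Z = map ?f es"
    unfolding singular_values_def es0(1) proots_prod_linear es_def by (simp add: rev_map)
  have sv: "singular_value Z (Suc i) = ?f (es ! i)" if "i < n" for i
    unfolding singular_value_def sv_list using len that by simp
  obtain U where U: "U \<in> carrier_mat n n" "mat_adjoint U * U = 1\<^sub>m n"
    and AU: "?A * U = U * mat_diag n (\<lambda>i. es ! i)"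
    using hermitian_diagonalization[OF A herm es] by blast
  define V where "V i x = U $$ (x, i)" for i x
  have ZU: "Z * U \<in> carrier_mat m n" using Z U(1) by auto
  have "mat_adjoint (Z * U) * (Z * U) = mat_adjoint U * (?A * U)"
    unfolding mat_adjoint_mult[OF Z U(1)]
    by (simp only: assoc_mult_mat[OF mat_adjoint_carrier[OF U(1)] Z' ZU] assoc_mult_mat[OF Z' Z U(1)])
  also have "\<dots> = mat_adjoint U * U * mat_diag n (\<lambda>i. es ! i)"
    unfolding AU by (rule assoc_mult_mat[symmetric, OF mat_adjoint_carrier[OF U(1)] U(1) mat_diag_dim])
  finally have D: "mat_adjoint (Z * U) * (Z * U) = mat_diag n (\<lambda>i. es ! i)"
    unfolding U(2) left_mult_one_mat[OF mat_diag_dim] .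
  have ip: "hinner m (mat_app Z (V i)) (mat_app Z (V k)) = (if i = k then es ! i else 0)"
    if "i < n" "k < n" for i k
  proof -
    have app: "(Z * U) $$ (l, i) = mat_app Z (V i) l" if "l < m" "i < n" for l i
      unfolding mat_app_def V_def using Z U(1) that by (subst index_mult_mat_sum) auto
    have "hinner m (mat_app Z (V i)) (mat_app Z (V k)) = (mat_adjoint (Z * U) * (Z * U)) $$ (i, k)"
      using that Z U(1) by (subst index_mult_mat_sum) (auto simp: hinner_def app simp del: index_mult_mat(1))
    then show ?thesis unfolding D using that by (simp add: mat_diag_def)
  qed
  \<comment> \<open>Each eigenvalue is a squared norm, hence real and nonnegative, so squaring the
    singular value recovers it.\<close>
  have e: "es ! i = of_real (hnorm2 m (mat_app Z (V i)))" if "i < n" for i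
    using ip[OF that that] by (simp add: hinner_self)
  have sq: "es ! i = of_real ((singular_value Z (Suc i))\<^sup>2)" if "i < n" for i
    using that by (simp add: sv e)
  show ?thesis
  proof (rule that)
    show "hinner n (V i) (V k) = (if i = k then 1 else 0)" if "i < n" "k < n" for i k
      unfolding V_def by (rule hinner_cols_unitary[OF U that])
    show "hinner m (mat_app Z (V i)) (mat_app Z (V k))
        = (if i = k then of_real ((singular_value Z (Suc i))\<^sup>2) else 0)" if "i < n" "k < n" for i k
      using ip[OF that] sq[OF that(1)] by auto
    show "f x = (\<Sum>i<n. hinner n (V i) f * V i x)" if "x < n" for f x
      unfolding V_def by (rule unitary_expansion[OF U that])
    show "0 \<le> singular_value Z (Suc i)" if "i < n" for i
      unfolding sv[OF that] e[OF that] by simp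
  qed
qed

text \<open>The Courant-Fischer bound: orthogonality to the first \<open>j - 1\<close> singular
  vectors leaves only singular values at most the \<open>j\<close>-th in the expansion of
  \<open>f\<close>. For \<open>j = 1\<close> the orthogonality is vacuous and the bound is that of
  the operator norm.\<close>

lemma hnorm2_mat_app_le:
  assumes Z: "Z \<in> carrier_mat m n" and j: "1 \<le> j" "j \<le> n"
    and exp: "\<And>x. x < n \<Longrightarrow> f x = (\<Sum>i<n. hinner n (V i) f * V i x)"
    and orth: "\<And>i k. i < n \<Longrightarrow> k < n \<Longrightarrow> hinner n (V i) (V k) = (if i = k then 1 else 0)"
    and orth': "\<And>i k. i < n \<Longrightarrow> k < n \<Longrightarrow> hinner m (mat_app Z (V i)) (mat_app Z (V k))
        = (if i = k then of_real ((singular_value Z (Suc i))\<^sup>2) else 0)"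
    and nonneg: "\<And>i. i < n \<Longrightarrow> 0 \<le> singular_value Z (Suc i)"
    and zero: "\<And>i. i < j - 1 \<Longrightarrow> hinner n (V i) f = 0"
  shows "hnorm2 m (mat_app Z f) \<le> (singular_value Z j)\<^sup>2 * hnorm2 n f"
proof -
  let ?c = "\<lambda>i. hinner n (V i) f"
  have "mat_app Z f = mat_app Z (\<lambda>x. \<Sum>i<n. ?c i * V i x)"
    using Z exp by (intro mat_app_cong) auto
  also have "\<dots> = (\<lambda>x. \<Sum>i<n. ?c i * mat_app Z (V i) x)"
    by (simp add: mat_app_sum mat_app_scale)
  finally have "hnorm2 m (mat_app Z f) = (\<Sum>i<n. (cmod (?c i))\<^sup>2 * (singular_value Z (Suc i))\<^sup>2)"
    using hnorm2_orthogonal_sum[of n m "\<lambda>i. mat_app Z (V i)"] orth' by simp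
  also have "\<dots> \<le> (\<Sum>i<n. (cmod (?c i))\<^sup>2 * (singular_value Z j)\<^sup>2)"
  proof (rule sum_mono)
    fix i assume "i \<in> {..<n}"
    then have i: "i < n" by simp
    show "(cmod (?c i))\<^sup>2 * (singular_value Z (Suc i))\<^sup>2 \<le> (cmod (?c i))\<^sup>2 * (singular_value Z j)\<^sup>2"
    proof (cases "i < j - 1")
      case False
      then have "singular_value Z (Suc i) \<le> singular_value Z j"
        using i j Z by (intro singular_value_antimono) auto
      then show ?thesis using nonneg[OF i] by (intro mult_left_mono power_mono) auto
    qed (simp add: zero)
  qed
  also have "\<dots> = (singular_value Z j)\<^sup>2 * (\<Sum>i<n. (cmod (?c i))\<^sup>2 * 1)"
    by (simp add: sum_distrib_left mult.commute)
  also have "(\<Sum>i<n. (cmod (?c i))\<^sup>2 * 1) = hnorm2 n (\<lambda>x. \<Sum>i<n. ?c i * V i x)"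
    by (rule hnorm2_orthogonal_sum[symmetric]) (use orth in auto)
  also have "\<dots> = hnorm2 n f" unfolding hnorm2_def using exp by (intro sum.cong) auto
  finally show ?thesis .
qed

text \<open>With z = B*y, |z|^2 = <y, Bz> is at most |y| |Bz|, and |Bz| is at most the largest
  singular value times |z|; one factor |z| is then cancelled.\<close>

lemma hnorm2_mat_app_adjoint_le:
  assumes B: "B \<in> carrier_mat m n" and n: "n \<ge> 1"
  shows "hnorm2 n (mat_app (mat_adjoint B) y) \<le> (singular_value B 1)\<^sup>2 * hnorm2 m y"
proof -
  let ?z = "mat_app (mat_adjoint B) y" and ?s = "(singular_value B 1)\<^sup>2"
  obtain V where V: "\<And>i k. i < n \<Longrightarrow> k < n \<Longrightarrow> hinner n (V i) (V k) = (if i = k then 1 else 0)"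
    "\<And>i k. i < n \<Longrightarrow> k < n \<Longrightarrow> hinner m (mat_app B (V i)) (mat_app B (V k))
        = (if i = k then of_real ((singular_value B (Suc i))\<^sup>2) else 0)"
    "\<And>f x. x < n \<Longrightarrow> f x = (\<Sum>i<n. hinner n (V i) f * V i x)"
    "\<And>i. i < n \<Longrightarrow> 0 \<le> singular_value B (Suc i)"
    using singular_basis[OF B] by blast
  have le: "hnorm2 m (mat_app B ?z) \<le> ?s * hnorm2 n ?z"
    by (rule hnorm2_mat_app_le[OF B _ n V(3) V(1) V(2) V(4)]) auto
  have "(hnorm2 n ?z)\<^sup>2 = (cmod (hinner n ?z ?z))\<^sup>2" by (simp add: hinner_self)
  also have "hinner n ?z ?z = hinner m y (mat_app B ?z)" by (rule hinner_mat_app_adjoint[OF B, symmetric])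
  also have "(cmod (hinner m y (mat_app B ?z)))\<^sup>2 \<le> hnorm2 m y * hnorm2 m (mat_app B ?z)"
    by (rule hinner_Cauchy_Schwarz)
  also have "\<dots> \<le> hnorm2 m y * (?s * hnorm2 n ?z)" by (rule mult_left_mono[OF le]) simp
  finally have "hnorm2 n ?z * hnorm2 n ?z \<le> (?s * hnorm2 m y) * hnorm2 n ?z"
    by (simp add: power2_eq_square algebra_simps)
  then show ?thesis
    by (cases "hnorm2 n ?z = 0") (use hnorm2_nonneg[of n ?z] in \<open>auto simp: mult_le_cancel_right\<close>)
qed

subsection \<open>The form of the map\<close>

text \<open>The change of variables a = p + q, b = p - q in the form of
  \<open>gram_form_nonneg\<close>. Here \<open>wp\<close> stands for <w,p> and similarly for the
  other pairs, while \<open>np\<close> and \<open>nq\<close> are squared norms.\<close>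

lemma polarization_identity:
  fixes wp wq yp yq qp :: complex and np nq \<alpha> r Y :: real
  shows "2 * \<alpha> * ((np + nq - 2 * Re qp) * r\<^sup>2 + (np + nq + 2 * Re qp) * Y)
      - 2 * r\<^sup>2 * (cmod (wp - wq))\<^sup>2 - ((cmod (wp + wq))\<^sup>2 + (cmod (wp - wq))\<^sup>2) * Y
      - (cmod (yp + yq))\<^sup>2 + (cmod (yp - yq))\<^sup>2
      + 2 * r * Re ((wp + wq) * cnj (yp - yq) - (wp - wq) * cnj (yp + yq))
    = 8 * ((\<alpha> * (np + nq) - ((cmod wp)\<^sup>2 + (cmod wq)\<^sup>2)) * ((r\<^sup>2 + Y) / 4)
      - 2 * \<alpha> * Re qp * ((r\<^sup>2 - Y) / 4)
      + 2 * Re ((of_real r * wp + yp) / 2 * cnj ((of_real r * wq - yq) / 2)))"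
  unfolding cmod_power2 by (simp add: power2_eq_square field_simps)

text \<open>The alternatives in the hypothesis on \<alpha> serve m > 1 and m = 1, and \<mu> is the
  multiplier of the real part of the trace in each. The last two summands on the right have no
  definite sign for a single pair \<open>p\<close>, \<open>q\<close>; they are controlled only after
  summation.\<close>

lemma form_bound_rank_one:
  fixes p q w y :: "nat \<Rightarrow> complex" and r Y S \<alpha> :: real
  assumes w: "hnorm2 n w \<le> S" and y: "hnorm2 n y \<le> S * Y" and r: "0 \<le> r" and Y: "0 \<le> Y"
    and \<alpha>: "3 / 2 * S \<le> \<alpha> \<and> \<mu> = S \<or> S \<le> \<alpha> \<and> \<mu> = 0 \<and> y = (\<lambda>i. \<eta> * w i) \<and> Y = (cmod \<eta>)\<^sup>2"
  defines "u \<equiv> (\<lambda>i. (of_real r * w i + y i) / 2)" and "v \<equiv> (\<lambda>i. (of_real r * w i - y i) / 2)"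
  shows "2 * \<alpha> * Re (hinner n q p) * ((r\<^sup>2 - Y) / 4) - 2 * Re (hinner n u p * hinner n q v)
    \<le> (\<alpha> * (hnorm2 n p + hnorm2 n q) - ((cmod (hinner n w p))\<^sup>2 + (cmod (hinner n w q))\<^sup>2)) * ((r\<^sup>2 + Y) / 4)
      - r * Im (hinner n w y) * Im (hinner n q p) - \<mu> * Y * Re (hinner n q p) / 2"
proof -
  let ?a = "\<lambda>i. p i + q i" and ?b = "\<lambda>i. p i - q i"
  have na: "hnorm2 n ?a = hnorm2 n p + hnorm2 n q + 2 * Re (hinner n q p)"
    and nb: "hnorm2 n ?b = hnorm2 n p + hnorm2 n q - 2 * Re (hinner n q p)"
    unfolding hnorm2_eq_Re hinner_linear by (simp_all flip: cnj_hinner[of n q p])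
  \<comment> \<open>Hence the added term of the Gram form sees only the imaginary part of <q,p>, the
    contribution of this pair to the trace.\<close>
  have ab: "hinner n ?a ?b - hinner n ?b ?a = 4 * \<i> * Im (hinner n q p)"
    unfolding hinner_linear by (simp add: complex_eq_iff flip: cnj_hinner[of n q p])
  have R2: "Re (hinner n w y * (hinner n ?a ?b - hinner n ?b ?a)) = - 4 * Im (hinner n w y) * Im (hinner n q p)"
    unfolding ab by simp
  have up: "hinner n u p = (of_real r * hinner n w p + hinner n y p) / 2"
  proof -
    have "u = (\<lambda>i. (1 / 2) * (of_real r * w i + y i))" unfolding u_def by auto
    then show ?thesis by (simp only: hinner_linear) simp
  qed
  have qv: "hinner n q v = cnj ((of_real r * hinner n w q - hinner n y q) / 2)"
  proof -
    have "v = (\<lambda>i. (1 / 2) * (of_real r * w i - y i))" unfolding v_def by auto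
    then show ?thesis by (simp only: hinner_linear) (simp add: cnj_hinner)
  qed
  have yb: "hinner n ?b y = cnj (hinner n y p - hinner n y q)"
    and ya: "hinner n ?a y = cnj (hinner n y p + hinner n y q)"
    by (simp_all add: hinner_linear cnj_hinner)
  have "0 \<le> 2 * \<alpha> * (hnorm2 n ?b * r\<^sup>2 + hnorm2 n ?a * Y) - 2 * r\<^sup>2 * (cmod (hinner n w ?b))\<^sup>2
     - ((cmod (hinner n w ?a))\<^sup>2 + (cmod (hinner n w ?b))\<^sup>2) * Y
     - (cmod (hinner n y ?a))\<^sup>2 + (cmod (hinner n y ?b))\<^sup>2
     + 2 * r * Re (hinner n w ?a * hinner n ?b y - hinner n w ?b * hinner n ?a y)
     + 2 * r * Re (hinner n w y * (hinner n ?a ?b - hinner n ?b ?a))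
     + \<mu> * (hnorm2 n ?b - hnorm2 n ?a) * Y"
    using \<alpha>
  proof (elim disjE conjE)
    assume "3 / 2 * S \<le> \<alpha>" "\<mu> = S"
    then show ?thesis using gram_form_nonneg[OF w y r Y, of \<alpha> ?b ?a] by simp
  next
    assume "S \<le> \<alpha>" "\<mu> = 0" and yw: "y = (\<lambda>i. \<eta> * w i)" and "Y = (cmod \<eta>)\<^sup>2"
    then show ?thesis using gram_form_nonneg_collinear[OF w yw r, of \<alpha> ?b ?a] by simp
  qed
  also have "\<dots> = 8 * ((\<alpha> * (hnorm2 n p + hnorm2 n q)
        - ((cmod (hinner n w p))\<^sup>2 + (cmod (hinner n w q))\<^sup>2)) * ((r\<^sup>2 + Y) / 4)
      - 2 * \<alpha> * Re (hinner n q p) * ((r\<^sup>2 - Y) / 4) + 2 * Re (hinner n u p * hinner n q v))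
     + 2 * r * (- 4 * Im (hinner n w y) * Im (hinner n q p)) + \<mu> * (- 4 * Re (hinner n q p)) * Y"
    unfolding up qv polarization_identity[symmetric] R2
    unfolding na nb yb ya by (simp add: hinner_add_right hinner_diff_right)
  finally have *: "0 \<le> \<dots>" .
  \<comment> \<open>Division by the factor 8 from the polarization identity, with the compound terms
    abstracted.\<close>
  have "T - 2 * R \<le> G - r * I * J - \<mu> * Y * Q / 2"
    if "0 \<le> 8 * (G - T + 2 * R) + 2 * r * (- 4 * I * J) + \<mu> * (- 4 * Q) * Y"
    for G T R I J Q :: real
    using that by (simp add: algebra_simps)
  from this[OF *] show ?thesis .
qed

text \<open>Summation of the rank-one bounds. The imaginary corrections add up to 0 because the
  total trace is real, and the real ones to -\<mu>Yt/2, which is at most 0 and is dropped.\<close>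

lemma form_bound_sum:
  fixes p q :: "nat \<Rightarrow> nat \<Rightarrow> complex" and w y :: "nat \<Rightarrow> complex" and r Y S \<alpha> :: real
  assumes w: "hnorm2 n w \<le> S" and y: "hnorm2 n y \<le> S * Y" and r: "0 \<le> r" and Y: "0 \<le> Y"
    and \<alpha>: "3 / 2 * S \<le> \<alpha> \<or> S \<le> \<alpha> \<and> (\<exists>\<eta>. y = (\<lambda>i. \<eta> * w i) \<and> Y = (cmod \<eta>)\<^sup>2)"
    and S: "0 \<le> S"
    and t: "(\<Sum>l\<in>L. hinner n (q l) (p l)) = of_real t" "0 \<le> t"
  defines "u \<equiv> (\<lambda>i. (of_real r * w i + y i) / 2)" and "v \<equiv> (\<lambda>i. (of_real r * w i - y i) / 2)"
  shows "2 * \<alpha> * t * ((r\<^sup>2 - Y) / 4) - 2 * Re (\<Sum>l\<in>L. hinner n u (p l) * hinner n (q l) v)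
    \<le> (\<alpha> * (\<Sum>l\<in>L. hnorm2 n (p l) + hnorm2 n (q l))
        - (\<Sum>l\<in>L. (cmod (hinner n w (p l)))\<^sup>2 + (cmod (hinner n w (q l)))\<^sup>2)) * ((r\<^sup>2 + Y) / 4)"
proof -
  obtain \<mu> \<eta> where \<mu>: "0 \<le> \<mu>"
    "3 / 2 * S \<le> \<alpha> \<and> \<mu> = S \<or> S \<le> \<alpha> \<and> \<mu> = 0 \<and> y = (\<lambda>i. \<eta> * w i) \<and> Y = (cmod \<eta>)\<^sup>2"
    using \<alpha> S by blast
  have Re_t: "(\<Sum>l\<in>L. Re (hinner n (q l) (p l))) = t" and Im_t: "(\<Sum>l\<in>L. Im (hinner n (q l) (p l))) = 0"
    using t(1) by (simp_all flip: Re_sum Im_sum)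
  have "(\<Sum>l\<in>L. 2 * \<alpha> * Re (hinner n (q l) (p l)) * ((r\<^sup>2 - Y) / 4) - 2 * Re (hinner n u (p l) * hinner n (q l) v))
    \<le> (\<Sum>l\<in>L. (\<alpha> * (hnorm2 n (p l) + hnorm2 n (q l))
        - ((cmod (hinner n w (p l)))\<^sup>2 + (cmod (hinner n w (q l)))\<^sup>2)) * ((r\<^sup>2 + Y) / 4)
      - r * Im (hinner n w y) * Im (hinner n (q l) (p l)) - \<mu> * Y * Re (hinner n (q l) (p l)) / 2)"
    unfolding u_def v_def by (intro sum_mono form_bound_rank_one[OF w y r Y \<mu>(2)])
  also have "\<dots> = (\<alpha> * (\<Sum>l\<in>L. hnorm2 n (p l) + hnorm2 n (q l))
        - (\<Sum>l\<in>L. (cmod (hinner n w (p l)))\<^sup>2 + (cmod (hinner n w (q l)))\<^sup>2)) * ((r\<^sup>2 + Y) / 4)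
      - r * Im (hinner n w y) * (\<Sum>l\<in>L. Im (hinner n (q l) (p l)))
      - \<mu> * Y * (\<Sum>l\<in>L. Re (hinner n (q l) (p l))) / 2"
    by (simp only: sum_subtractf sum_distrib_left sum_distrib_right sum_divide_distrib left_diff_distrib)
  also have "\<dots> \<le> (\<alpha> * (\<Sum>l\<in>L. hnorm2 n (p l) + hnorm2 n (q l))
        - (\<Sum>l\<in>L. (cmod (hinner n w (p l)))\<^sup>2 + (cmod (hinner n w (q l)))\<^sup>2)) * ((r\<^sup>2 + Y) / 4)"
    unfolding Re_t Im_t using \<mu>(1) Y t(2) by simp
  also have "(\<Sum>l\<in>L. 2 * \<alpha> * Re (hinner n (q l) (p l)) * ((r\<^sup>2 - Y) / 4) - 2 * Re (hinner n u (p l) * hinner n (q l) v))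
     = 2 * \<alpha> * t * ((r\<^sup>2 - Y) / 4) - 2 * Re (\<Sum>l\<in>L. hinner n u (p l) * hinner n (q l) v)"
    unfolding Re_t[symmetric] by (simp only: sum_subtractf sum_distrib_left sum_distrib_right Re_sum)
  finally show ?thesis .
qed

section \<open>From rank-one sums to the quadratic forms of the map\<close>

lemma hinner_mat_app_sum:
  assumes X: "X \<in> carrier_mat n n"
    and rep: "\<And>i k. i < n \<Longrightarrow> k < n \<Longrightarrow> X $$ (i, k) = (\<Sum>l<N. p l i * cnj (q l k))"
  shows "hinner n f (mat_app X g) = (\<Sum>l<N. hinner n f (p l) * hinner n (q l) g)"
proof -
  have "mat_app X g i = (\<Sum>l<N. hinner n (q l) g * p l i)" if "i < n" for i
  proof -
    have "mat_app X g i = (\<Sum>k<n. \<Sum>l<N. p l i * cnj (q l k) * g k)"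
      using X that rep unfolding mat_app_def by (auto simp: sum_distrib_right intro!: sum.cong)
    also have "\<dots> = (\<Sum>l<N. hinner n (q l) g * p l i)"
      by (subst sum.swap) (simp add: hinner_def sum_distrib_left sum_distrib_right algebra_simps)
    finally show ?thesis .
  qed
  then have "hinner n f (mat_app X g) = hinner n f (\<lambda>i. \<Sum>l<N. hinner n (q l) g * p l i)"
    by (intro hinner_cong) auto
  then show ?thesis
    by (simp only: hinner_sum_right hinner_scale_right) (simp add: mult.commute)
qed

lemma trace_mat_sum:
  assumes X: "X \<in> carrier_mat n n"
    and rep: "\<And>i k. i < n \<Longrightarrow> k < n \<Longrightarrow> X $$ (i, k) = (\<Sum>l<N. p l i * cnj (q l k))"
  shows "trace_mat X = (\<Sum>l<N. hinner n (q l) (p l))"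
  using X unfolding trace_mat_def hinner_def
  by (subst sum.swap) (auto simp: rep mult.commute intro!: sum.cong)

lemma Phi_minus_carrier:
  assumes "B \<in> carrier_mat m n" "Y \<in> carrier_mat n n"
  shows "Phi_minus \<alpha> B Y \<in> carrier_mat m m"
  using assms unfolding Phi_minus_def by (intro minus_carrier_mat) auto

lemma hinner_Phi_minus:
  assumes B: "B \<in> carrier_mat m n" and Y: "Y \<in> carrier_mat n n"
  shows "hinner m u (mat_app (Phi_minus \<alpha> B Y) v) = of_real \<alpha> * trace_mat Y * hinner m u v
    - hinner n (mat_app (mat_adjoint B) u) (mat_app Y (mat_app (mat_adjoint B) v))"
proof -
  let ?z = "mat_app Y (mat_app (mat_adjoint B) v)"
  have B': "mat_adjoint B \<in> carrier_mat n m" using B by simp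
  have BY: "B * Y \<in> carrier_mat m n" and BYB: "B * Y * mat_adjoint B \<in> carrier_mat m m"
    using B Y B' by auto
  have app: "mat_app (Phi_minus \<alpha> B Y) v i = (of_real \<alpha> * trace_mat Y) * v i - mat_app B ?z i"
    if i: "i < m" for i
  proof -
    have "mat_app (Phi_minus \<alpha> B Y) v i
        = (\<Sum>k<m. (if k = i then of_real \<alpha> * trace_mat Y * v k else 0)
            - (B * Y * mat_adjoint B) $$ (i, k) * v k)"
      using B BYB i Phi_minus_carrier[OF B Y, of \<alpha>] unfolding mat_app_def
      by (auto simp: Phi_minus_def algebra_simps simp del: index_mult_mat intro!: sum.cong)
    also have "\<dots> = of_real \<alpha> * trace_mat Y * v i - mat_app (B * Y * mat_adjoint B) v i"
      using i BYB by (simp add: sum_subtractf mat_app_def del: index_mult_mat)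
    also have "mat_app (B * Y * mat_adjoint B) v i = mat_app (B * Y) (mat_app (mat_adjoint B) v) i"
      by (rule mat_app_mult[OF BY B' i])
    also have "\<dots> = mat_app B ?z i" by (rule mat_app_mult[OF B Y i])
    finally show ?thesis .
  qed
  have "hinner m u (mat_app (Phi_minus \<alpha> B Y) v)
      = hinner m u (\<lambda>i. (of_real \<alpha> * trace_mat Y) * v i - mat_app B ?z i)"
    by (intro hinner_cong app refl)
  also have "\<dots> = of_real \<alpha> * trace_mat Y * hinner m u v - hinner m u (mat_app B ?z)"
    by (simp only: hinner_linear)
  also have "hinner m u (mat_app B ?z) = hinner n (mat_app (mat_adjoint B) u) ?z"
    by (rule hinner_mat_app_adjoint[OF B])
  finally show ?thesis .
qed

text \<open>There are \<open>j - 1\<close> equations in \<open>j\<close> unknowns. A zero row makes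
  the system square with determinant 0.\<close>

lemma homogeneous_system_nontrivial:
  fixes a :: "nat \<Rightarrow> nat \<Rightarrow> complex"
  assumes "1 \<le> j"
  shows "\<exists>c. (\<exists>i<j. c i \<noteq> 0) \<and> (\<forall>l<j - 1. (\<Sum>i<j. c i * a l i) = 0)"
proof -
  define A where "A = mat j j (\<lambda>(l, i). if l < j - 1 then a l i else 0)"
  have A: "A \<in> carrier_mat j j" unfolding A_def by simp
  have "det A = 0"
  proof -
    have "A = mat\<^sub>r j j (\<lambda>l. if l = j - 1 then 0\<^sub>v j else row A l)"
      using assms by (intro eq_matI) (auto simp: A_def)
    also have "det \<dots> = 0"
      using assms A by (intro det_row_0) auto
    finally show ?thesis .
  qed
  then obtain x where x: "x \<in> carrier_vec j" "x \<noteq> 0\<^sub>v j" "A *\<^sub>v x = 0\<^sub>v j"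
    using det_0_iff_vec_prod_zero[OF A] by blast
  have "\<exists>i<j. x $ i \<noteq> 0"
  proof (rule ccontr)
    assume "\<not> (\<exists>i<j. x $ i \<noteq> 0)"
    then have "x = 0\<^sub>v j" using x(1) by (intro eq_vecI) auto
    with x(2) show False ..
  qed
  moreover have "(\<Sum>i<j. x $ i * a l i) = 0" if "l < j - 1" for l
  proof -
    have "0 = (A *\<^sub>v x) $ l" using x(3) that by simp
    also have "\<dots> = (\<Sum>i<j. x $ i * a l i)"
      using that x(1) by (auto simp: A_def scalar_prod_def atLeast0LessThan intro!: sum.cong)
    finally show ?thesis ..
  qed
  ultimately show ?thesis by (intro exI[of _ "\<lambda>i. x $ i"]) auto
qed

lemma mat_app_add_mat:
  assumes "A \<in> carrier_mat m n" "C \<in> carrier_mat m n" "i < m"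
  shows "mat_app (A + C) f i = mat_app A f i + mat_app C f i"
  using assms unfolding mat_app_def by (simp add: sum.distrib algebra_simps)

text \<open>The block matrix is a sum of rank-one matrices, and the upper and lower halves of their
  vectors provide \<open>p l\<close> and \<open>q l\<close>. Moving \<open>B\<close> to the other
  side of the inner products reduces the claim to \<open>form_bound_sum\<close> for the images of
  \<open>w\<close> and \<open>y\<close> under B*.\<close>

lemma Phi_minus_form_bound:
  assumes m: "m \<ge> 1" and n: "n \<ge> 1"
    and B: "B \<in> carrier_mat m n"
    and A: "A \<in> carrier_mat n n" and X: "X \<in> carrier_mat n n" and C: "C \<in> carrier_mat n n"
    and psd: "positive_semidefinite (four_block_mat A X (mat_adjoint X) C)"
    and \<alpha>: "\<alpha> \<ge> (real m + 1) / 2 * (singular_value B 1)\<^sup>2"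
    and \<omega>: "cmod \<omega> = 1" "\<omega> * trace_mat X = of_real t" "0 \<le> t"
    and w: "hnorm2 m w = 1" and r: "0 \<le> r"
    and uv: "\<And>x. x < m \<Longrightarrow> u x + v x = of_real r * w x"
  shows "2 * Re (\<omega> * hinner m u (mat_app (Phi_minus \<alpha> B X) v))
    \<le> Re (hinner m w (mat_app (Phi_minus \<alpha> B (A + C)) w)) * ((hnorm2 m u + hnorm2 m v) / 2)"
proof -
  let ?M = "four_block_mat A X (mat_adjoint X) C"
  let ?h = "mat_app (mat_adjoint B)"
  define S where "S = (singular_value B 1)\<^sup>2"
  have S0: "0 \<le> S" unfolding S_def by simp
  have M: "?M \<in> carrier_mat (n + n) (n + n)" using A C by auto
  obtain z where z: "\<And>i j. i < n + n \<Longrightarrow> j < n + n \<Longrightarrow>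
      ?M $$ (i, j) = (\<Sum>l<n + n. z l i * cnj (z l j))"
    using positive_semidefinite_sum_rank_one[OF M psd] by blast
  define q where "q l i = z l (n + i)" for l i
  \<comment> \<open>The phase is absorbed into the upper halves. This replaces X by \<omega>X and
    leaves A unchanged because |\<omega>| = 1.\<close>
  define p where "p l i = \<omega> * z l i" for l i
  have \<omega>1: "\<omega> * cnj \<omega> = 1" using \<omega>(1) by (simp add: complex_norm_square[symmetric])
  have repA: "A $$ (i, k) = (\<Sum>l<n + n. p l i * cnj (p l k))" if "i < n" "k < n" for i k
  proof -
    have "A $$ (i, k) = (\<Sum>l<n + n. z l i * cnj (z l k))"
      using z[of i k] that A C by simp
    also have "\<dots> = (\<Sum>l<n + n. (\<omega> * cnj \<omega>) * (z l i * cnj (z l k)))" unfolding \<omega>1 by simp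
    finally show ?thesis unfolding p_def by (simp add: algebra_simps)
  qed
  have repC: "C $$ (i, k) = (\<Sum>l<n + n. q l i * cnj (q l k))" if "i < n" "k < n" for i k
    using z[of "n + i" "n + k"] that A C unfolding q_def by simp
  have repX: "X $$ (i, k) = (\<Sum>l<n + n. z l i * cnj (q l k))" if "i < n" "k < n" for i k
    using z[of "i" "n + k"] that A C X unfolding q_def by simp
  define y where "y x = u x - v x" for x
  define Y where "Y = hnorm2 m y"
  have Y0: "0 \<le> Y" unfolding Y_def by simp
  have uvy: "u x = (of_real r * w x + y x) / 2" "v x = (of_real r * w x - y x) / 2" if "x < m" for x
    unfolding uv[OF that, symmetric] y_def by simp_all
  have hat: "?h u = (\<lambda>i. (of_real r * ?h w i + ?h y i) / 2)"
    "?h v = (\<lambda>i. (of_real r * ?h w i - ?h y i) / 2)"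
  proof -
    have "?h u = ?h (\<lambda>x. (1 / 2) * (of_real r * w x + y x))"
      using B by (intro mat_app_cong) (simp add: uvy)
    then show "?h u = (\<lambda>i. (of_real r * ?h w i + ?h y i) / 2)"
      by (simp only: mat_app_scale mat_app_add) simp
    have "?h v = ?h (\<lambda>x. (1 / 2) * (of_real r * w x - y x))"
      using B by (intro mat_app_cong) (simp add: uvy)
    then show "?h v = (\<lambda>i. (of_real r * ?h w i - ?h y i) / 2)"
      by (simp only: mat_app_scale mat_app_diff) simp
  qed
  have hw: "hnorm2 n (?h w) \<le> S"
    using hnorm2_mat_app_adjoint_le[OF B n, of w] w unfolding S_def by simp
  have hy: "hnorm2 n (?h y) \<le> S * Y"
    using hnorm2_mat_app_adjoint_le[OF B n, of y] unfolding S_def Y_def by simp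
  \<comment> \<open>For m > 1 the factor (m + 1)/2 is at least 3/2. For m = 1 it equals 1, and
    \<open>y\<close> is a multiple of \<open>w\<close>, whose single coordinate has modulus
    1.\<close>
  have cond: "3 / 2 * S \<le> \<alpha> \<or> S \<le> \<alpha> \<and> (\<exists>\<eta>. ?h y = (\<lambda>i. \<eta> * ?h w i) \<and> Y = (cmod \<eta>)\<^sup>2)"
  proof (cases "m = 1")
    case False
    then have "3 / 2 * S \<le> (real m + 1) / 2 * S"
      using m S0 by (intro mult_right_mono) auto
    then show ?thesis using \<alpha> unfolding S_def by linarith
  next
    case True
    then have w1: "(cmod (w 0))\<^sup>2 = 1" using w unfolding hnorm2_def by simp
    then have w0: "w 0 \<noteq> 0" by auto
    let ?\<eta> = "y 0 / w 0"
    have "?h y = ?h (\<lambda>x. ?\<eta> * w x)"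
      using B True w0 by (intro mat_app_cong) simp
    then have "?h y = (\<lambda>i. ?\<eta> * ?h w i)" by (simp only: mat_app_scale)
    moreover have "Y = (cmod ?\<eta>)\<^sup>2"
      unfolding Y_def hnorm2_def using True w1 by (simp add: norm_divide power_divide)
    moreover have "S \<le> \<alpha>" using \<alpha> True unfolding S_def by simp
    ultimately show ?thesis by blast
  qed
  have zp: "hinner n (q l) (p l) = \<omega> * hinner n (q l) (z l)" for l
    unfolding p_def by (rule hinner_scale_right)
  have "trace_mat X = (\<Sum>l<n + n. hinner n (q l) (z l))"
    by (rule trace_mat_sum[OF X repX])
  then have t: "(\<Sum>l<n + n. hinner n (q l) (p l)) = of_real t"
    unfolding zp \<omega>(2)[symmetric] by (simp add: sum_distrib_left)
  note bound = form_bound_sum[OF hw hy r Y0 cond S0 t \<omega>(3), folded hat]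
  \<comment> \<open>Together with \<open>sum_uv\<close>, this is polarization and the parallelogram
    law for u = (rw + y)/2 and v = (rw - y)/2 with |w| = 1.\<close>
  have Re_uv: "Re (hinner m u v) = (r\<^sup>2 - Y) / 4"
  proof -
    have "hinner m u v = hinner m (\<lambda>x. (1 / 2) * (of_real r * w x + y x)) (\<lambda>x. (1 / 2) * (of_real r * w x - y x))"
      by (intro hinner_cong) (simp_all add: uvy)
    also have "\<dots> = (of_real (r\<^sup>2) * hinner m w w - hinner m y y
        + of_real r * (hinner m y w - hinner m w y)) / 4"
      by (simp only: hinner_linear) (simp add: power2_eq_square algebra_simps)
    finally have "Re (hinner m u v) = Re \<dots>" by (rule arg_cong)
    then show ?thesis
      by (simp add: hinner_self w power2_eq_square flip: Y_def cnj_hinner[of m w y])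
  qed
  have sum_uv: "(hnorm2 m u + hnorm2 m v) / 2 = (r\<^sup>2 + Y) / 4"
  proof -
    have "hnorm2 m u + hnorm2 m v = Re (hinner m (\<lambda>x. (1 / 2) * (of_real r * w x + y x)) (\<lambda>x. (1 / 2) * (of_real r * w x + y x)))
        + Re (hinner m (\<lambda>x. (1 / 2) * (of_real r * w x - y x)) (\<lambda>x. (1 / 2) * (of_real r * w x - y x)))"
      unfolding hnorm2_eq_Re by (intro arg_cong2[where f = plus] arg_cong[where f = Re] hinner_cong) (simp_all add: uvy)
    also have "\<dots> = Re ((of_real (r\<^sup>2) * hinner m w w + hinner m y y) / 2)"
      by (simp only: hinner_linear plus_complex.simps[symmetric]) (simp add: power2_eq_square field_simps)
    finally show ?thesis by (simp add: hinner_self w flip: Y_def)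
  qed
  have "hinner n (?h u) (mat_app X (?h v)) = (\<Sum>l<n + n. hinner n (?h u) (z l) * hinner n (q l) (?h v))"
    by (rule hinner_mat_app_sum[OF X repX])
  then have "\<omega> * hinner m u (mat_app (Phi_minus \<alpha> B X) v)
      = of_real \<alpha> * (\<omega> * trace_mat X) * hinner m u v - \<omega> * (\<Sum>l<n + n. hinner n (?h u) (z l) * hinner n (q l) (?h v))"
    unfolding hinner_Phi_minus[OF B X] by (simp add: algebra_simps)
  also have "\<omega> * (\<Sum>l<n + n. hinner n (?h u) (z l) * hinner n (q l) (?h v))
      = (\<Sum>l<n + n. hinner n (?h u) (p l) * hinner n (q l) (?h v))"
    unfolding p_def hinner_scale_right by (simp add: sum_distrib_left mult.assoc)
  finally have lhs: "2 * Re (\<omega> * hinner m u (mat_app (Phi_minus \<alpha> B X) v))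
      = 2 * \<alpha> * t * ((r\<^sup>2 - Y) / 4) - 2 * Re (\<Sum>l<n + n. hinner n (?h u) (p l) * hinner n (q l) (?h v))"
    unfolding \<omega>(2) by (simp add: Re_uv)
  have AC: "A + C \<in> carrier_mat n n" using A C by auto
  have "trace_mat (A + C) = trace_mat A + trace_mat C"
    using A C unfolding trace_mat_def by (simp add: sum.distrib)
  also have "trace_mat A = (\<Sum>l<n + n. hinner n (p l) (p l))"
    by (rule trace_mat_sum[OF A repA])
  also have "trace_mat C = (\<Sum>l<n + n. hinner n (q l) (q l))"
    by (rule trace_mat_sum[OF C repC])
  also have "(\<Sum>l<n + n. hinner n (p l) (p l)) + (\<Sum>l<n + n. hinner n (q l) (q l))
      = of_real (\<Sum>l<n + n. hnorm2 n (p l) + hnorm2 n (q l))"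
    unfolding hinner_self by (simp add: sum.distrib)
  finally have tr: "trace_mat (A + C) = of_real (\<Sum>l<n + n. hnorm2 n (p l) + hnorm2 n (q l))" .
  have sq: "hinner n f g * hinner n g f = of_real ((cmod (hinner n f g))\<^sup>2)" for f g
    unfolding complex_norm_square cnj_hinner ..
  have "hinner n (?h w) (mat_app (A + C) (?h w))
      = hinner n (?h w) (mat_app A (?h w)) + hinner n (?h w) (mat_app C (?h w))"
    unfolding hinner_add_right[symmetric] by (intro hinner_cong mat_app_add_mat[OF A C] refl)
  also have "hinner n (?h w) (mat_app A (?h w)) = (\<Sum>l<n + n. hinner n (?h w) (p l) * hinner n (p l) (?h w))"
    by (rule hinner_mat_app_sum[OF A repA])
  also have "hinner n (?h w) (mat_app C (?h w)) = (\<Sum>l<n + n. hinner n (?h w) (q l) * hinner n (q l) (?h w))"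
    by (rule hinner_mat_app_sum[OF C repC])
  also have "(\<Sum>l<n + n. hinner n (?h w) (p l) * hinner n (p l) (?h w))
      + (\<Sum>l<n + n. hinner n (?h w) (q l) * hinner n (q l) (?h w))
      = of_real (\<Sum>l<n + n. (cmod (hinner n (?h w) (p l)))\<^sup>2 + (cmod (hinner n (?h w) (q l)))\<^sup>2)"
    unfolding sq by (simp add: sum.distrib)
  finally have rhs: "Re (hinner m w (mat_app (Phi_minus \<alpha> B (A + C)) w))
      = \<alpha> * (\<Sum>l<n + n. hnorm2 n (p l) + hnorm2 n (q l))
        - (\<Sum>l<n + n. (cmod (hinner n (?h w) (p l)))\<^sup>2 + (cmod (hinner n (?h w) (q l)))\<^sup>2)"
    unfolding hinner_Phi_minus[OF B AC] tr by (simp add: hinner_self w)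
  show ?thesis unfolding lhs rhs sum_uv by (rule bound)
qed

section \<open>Comparison of the singular values\<close>

theorem theorem5p4:
  fixes m n :: nat and \<alpha> :: real and A B C X :: "complex mat"
  assumes "m \<ge> 1" and "n \<ge> 1"
    and "B \<in> carrier_mat m n"
    and "A \<in> carrier_mat n n" and "X \<in> carrier_mat n n" and "C \<in> carrier_mat n n"
    and "positive_semidefinite (four_block_mat A X (mat_adjoint X) C)"
    and "\<alpha> \<ge> (real m + 1) / 2 * (singular_value B 1)\<^sup>2"
  shows "\<forall>j \<in> {1..m}. 2 * singular_value (Phi_minus \<alpha> B X) j
                    \<le> singular_value (Phi_minus \<alpha> B (A + C)) j"
proof
  fix j assume "j \<in> {1..m}"
  then have j: "1 \<le> j" "j \<le> m" and jm: "j - 1 < m" "Suc (j - 1) = j" by auto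
  let ?Z = "Phi_minus \<alpha> B X" and ?T = "Phi_minus \<alpha> B (A + C)"
  have Z: "?Z \<in> carrier_mat m m" by (rule Phi_minus_carrier[OF assms(3,5)])
  have T: "?T \<in> carrier_mat m m" by (rule Phi_minus_carrier[OF assms(3)]) (use assms(4,6) in auto)
  obtain V where V: "\<And>i k. i < m \<Longrightarrow> k < m \<Longrightarrow> hinner m (V i) (V k) = (if i = k then 1 else 0)"
    "\<And>i k. i < m \<Longrightarrow> k < m \<Longrightarrow> hinner m (mat_app ?Z (V i)) (mat_app ?Z (V k))
        = (if i = k then of_real ((singular_value ?Z (Suc i))\<^sup>2) else 0)"
    "\<And>f x. x < m \<Longrightarrow> f x = (\<Sum>i<m. hinner m (V i) f * V i x)"
    "\<And>i. i < m \<Longrightarrow> 0 \<le> singular_value ?Z (Suc i)"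
    using singular_basis[OF Z] by blast
  obtain W where W: "\<And>i k. i < m \<Longrightarrow> k < m \<Longrightarrow> hinner m (W i) (W k) = (if i = k then 1 else 0)"
    "\<And>i k. i < m \<Longrightarrow> k < m \<Longrightarrow> hinner m (mat_app ?T (W i)) (mat_app ?T (W k))
        = (if i = k then of_real ((singular_value ?T (Suc i))\<^sup>2) else 0)"
    "\<And>f x. x < m \<Longrightarrow> f x = (\<Sum>i<m. hinner m (W i) f * W i x)"
    "\<And>i. i < m \<Longrightarrow> 0 \<le> singular_value ?T (Suc i)"
    using singular_basis[OF T] by blast
  define \<tau> where "\<tau> = singular_value ?T j"
  define \<sigma> where "\<sigma> i = singular_value ?Z (Suc i)" for i
  have \<tau>0: "0 \<le> \<tau>" unfolding \<tau>_def using W(4)[OF jm(1)] jm(2) by simp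
  \<comment> \<open>\<sigma> is numbered from 0. A vanishing value makes the claim trivial;
    otherwise the first \<open>j\<close> values are positive and can be divided by.\<close>
  have "2 * \<sigma> (j - 1) \<le> \<tau>"
  proof (cases "\<sigma> (j - 1) = 0")
    case True
    then show ?thesis using \<tau>0 by simp
  next
    case False
    then have pos: "0 < \<sigma> (j - 1)" using V(4)[OF jm(1)] unfolding \<sigma>_def by simp
    have le: "\<sigma> (j - 1) \<le> \<sigma> i" if "i < j" for i
      unfolding \<sigma>_def using that j Z by (intro singular_value_antimono) auto
    have pos': "0 < \<sigma> i" if "i < j" for i using le[OF that] pos by linarith
    \<comment> \<open>The conjugate phase of the trace of X, or 1 if the trace is 0.\<close>
    obtain \<omega> t where \<omega>: "cmod \<omega> = 1" "\<omega> * trace_mat X = of_real t" "0 \<le> t"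
    proof (cases "trace_mat X = 0")
      case True
      then show ?thesis using that[of 1 0] by simp
    next
      case False
      let ?c = "trace_mat X"
      have "cnj ?c / of_real (cmod ?c) * ?c = of_real (cmod ?c)"
        using False complex_norm_square[of ?c] by (simp add: field_simps power2_eq_square)
      then show ?thesis using that[of "cnj ?c / of_real (cmod ?c)" "cmod ?c"] False
        by (simp add: norm_divide)
    qed
    have \<omega>1: "cnj \<omega> * \<omega> = 1" "\<omega> * cnj \<omega> = 1" using \<omega>(1) by (simp_all add: complex_norm_square[symmetric] mult.commute)
    \<comment> \<open>Left singular vectors of \<omega>\<Phi>(X) belonging to the right singular
      vectors \<open>V i\<close>.\<close>
    define P where "P i x = \<omega> / of_real (\<sigma> i) * mat_app ?Z (V i) x" for i x
    have PP: "hinner m (P i) (P k) = (if i = k then 1 else 0)" if "i < j" "k < j" for i k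
    proof -
      have "hinner m (P i) (P k) = cnj \<omega> * \<omega> / (of_real (\<sigma> i) * of_real (\<sigma> k))
          * hinner m (mat_app ?Z (V i)) (mat_app ?Z (V k))"
        unfolding P_def hinner_scale_left hinner_scale_right by simp
      then show ?thesis unfolding \<omega>1 using V(2)[of i k] that j pos'[OF that(1)]
        by (auto simp: \<sigma>_def[symmetric] power2_eq_square)
    qed
    have PZ: "\<omega> * hinner m (P i) (mat_app ?Z (V k)) = (if i = k then of_real (\<sigma> i) else 0)"
      if "i < j" "k < j" for i k
    proof -
      have "\<omega> * hinner m (P i) (mat_app ?Z (V k)) = \<omega> * cnj \<omega> / of_real (\<sigma> i)
          * hinner m (mat_app ?Z (V i)) (mat_app ?Z (V k))"
        unfolding P_def hinner_scale_left by simp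
      then show ?thesis unfolding \<omega>1 using V(2)[of i k] that j pos'[OF that(1)]
        by (auto simp: \<sigma>_def[symmetric] power2_eq_square)
    qed
    obtain c where c: "\<exists>i<j. c i \<noteq> 0"
      and c0: "\<And>l. l < j - 1 \<Longrightarrow> (\<Sum>i<j. c i * hinner m (W l) (\<lambda>x. P i x + V i x)) = 0"
      using homogeneous_system_nontrivial[OF j(1), of "\<lambda>l i. hinner m (W l) (\<lambda>x. P i x + V i x)"]
      by blast
    define u where "u x = (\<Sum>i<j. c i * P i x)" for x
    define v where "v x = (\<Sum>i<j. c i * V i x)" for x
    define N where "N = (\<Sum>i<j. (cmod (c i))\<^sup>2)"
    have N: "0 < N"
    proof -
      from c obtain i where "i < j" "c i \<noteq> 0" by blast
      then show ?thesis unfolding N_def by (intro sum_pos2[of _ i]) auto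
    qed
    have nu: "hnorm2 m u = N"
      unfolding u_def N_def using hnorm2_orthogonal_sum[of j m P "\<lambda>_. 1" c] PP by simp
    have nv: "hnorm2 m v = N"
      unfolding v_def N_def using hnorm2_orthogonal_sum[of j m V "\<lambda>_. 1" c] V(1) j by simp
    have "\<omega> * hinner m u (mat_app ?Z v)
        = (\<Sum>i<j. \<Sum>k<j. cnj (c i) * c k * (\<omega> * hinner m (P i) (mat_app ?Z (V k))))"
      unfolding u_def v_def mat_app_sum mat_app_scale
      by (simp add: hinner_sum_left hinner_sum_right hinner_scale_left hinner_scale_right
          sum_distrib_left algebra_simps)
    also have "\<dots> = (\<Sum>i<j. \<Sum>k<j. if k = i then cnj (c i) * c i * of_real (\<sigma> i) else 0)"
      by (intro sum.cong refl) (auto simp: PZ)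
    also have "\<dots> = (\<Sum>i<j. cnj (c i) * c i * of_real (\<sigma> i))"
      by (intro sum.cong refl) auto
    also have "\<dots> = of_real (\<Sum>i<j. (cmod (c i))\<^sup>2 * \<sigma> i)"
      unfolding of_real_sum of_real_mult complex_norm_square by (simp add: mult.commute)
    finally have "Re (\<omega> * hinner m u (mat_app ?Z v)) = (\<Sum>i<j. (cmod (c i))\<^sup>2 * \<sigma> i)"
      by simp
    moreover have "\<sigma> (j - 1) * N \<le> (\<Sum>i<j. (cmod (c i))\<^sup>2 * \<sigma> i)"
      unfolding N_def sum_distrib_left using le by (intro sum_mono) (simp add: mult.commute mult_right_mono)
    ultimately have low: "\<sigma> (j - 1) * N \<le> Re (\<omega> * hinner m u (mat_app ?Z v))" by simp
    define f where "f x = u x + v x" for x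
    have f_eq: "f x = (\<Sum>i<j. c i * (P i x + V i x))" for x
      unfolding f_def u_def v_def by (simp add: sum.distrib distrib_left)
    have f0: "hinner m (W l) f = 0" if "l < j - 1" for l
      using c0[OF that] unfolding f_eq[abs_def] hinner_sum_right hinner_scale_right .
    have Tf: "hnorm2 m (mat_app ?T f) \<le> \<tau>\<^sup>2 * hnorm2 m f"
      unfolding \<tau>_def by (rule hnorm2_mat_app_le[OF T j W(3) W(1) W(2) W(4) f0])
    \<comment> \<open>If u + v = 0, then \<open>r = 0\<close> and \<open>w\<close> is free, and the
      \<open>j\<close>-th singular vector of \<open>?T\<close> satisfies the norm bound. Otherwise
      \<open>w\<close> is the normalized sum and inherits the bound from \<open>Tf\<close>.\<close>
    obtain w r where w: "hnorm2 m w = 1" "0 \<le> r" "\<And>x. x < m \<Longrightarrow> f x = of_real r * w x"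
      and Tw: "hnorm2 m (mat_app ?T w) \<le> \<tau>\<^sup>2"
    proof (cases "hnorm2 m f = 0")
      case True
      have "hnorm2 m (W (j - 1)) = 1" "hnorm2 m (mat_app ?T (W (j - 1))) = \<tau>\<^sup>2"
        unfolding hnorm2_eq_Re W(1)[OF jm(1) jm(1)] W(2)[OF jm(1) jm(1)] jm(2) \<tau>_def by simp_all
      then show ?thesis using that[of "W (j - 1)" 0] True by (simp add: hnorm2_eq_0_iff)
    next
      case False
      define r where "r = sqrt (hnorm2 m f)"
      have r: "0 < r" "r\<^sup>2 = hnorm2 m f" unfolding r_def using False by (simp_all add: order_less_le)
      have "hnorm2 m (mat_app ?T (\<lambda>x. 1 / of_real r * f x)) = hnorm2 m (mat_app ?T f) / r\<^sup>2"
        unfolding mat_app_scale hnorm2_scale using r by (simp add: norm_divide power_divide)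
      also have "\<dots> \<le> \<tau>\<^sup>2" using Tf r(1) unfolding r(2)[symmetric] by (simp add: divide_le_eq)
      finally have *: "hnorm2 m (mat_app ?T (\<lambda>x. 1 / of_real r * f x)) \<le> \<tau>\<^sup>2" .
      have "hnorm2 m (\<lambda>x. 1 / of_real r * f x) = 1"
        unfolding hnorm2_scale using r False by (simp add: norm_divide power_divide)
      with * show ?thesis using that[of "\<lambda>x. 1 / of_real r * f x" r] r by simp
    qed
    have "(cmod (hinner m w (mat_app ?T w)))\<^sup>2 \<le> \<tau>\<^sup>2"
      using hinner_Cauchy_Schwarz[of m w "mat_app ?T w"] Tw w(1) by simp
    then have "cmod (hinner m w (mat_app ?T w)) \<le> \<tau>" by (rule power2_le_imp_le[OF _ \<tau>0])
    then have wTw: "Re (hinner m w (mat_app ?T w)) \<le> \<tau>"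
      using complex_Re_le_cmod order_trans by blast
    have "2 * Re (\<omega> * hinner m u (mat_app ?Z v))
        \<le> Re (hinner m w (mat_app ?T w)) * ((hnorm2 m u + hnorm2 m v) / 2)"
      by (rule Phi_minus_form_bound[OF assms \<omega> w(1,2)]) (use w(3) in \<open>simp add: f_def\<close>)
    also have "\<dots> \<le> \<tau> * N" unfolding nu nv using wTw N by (simp add: mult_right_mono)
    \<comment> \<open>Both \<open>u\<close> and \<open>v\<close> have squared norm \<open>N\<close>,
      so the lower bound \<open>low\<close> and the form bound meet, and \<open>N > 0\<close>
      cancels.\<close>
    finally have "(2 * \<sigma> (j - 1)) * N \<le> \<tau> * N" using low by simp
    then show ?thesis using N by simp
  qed
  then show "2 * singular_value ?Z j \<le> singular_value ?T j"
    unfolding \<sigma>_def \<tau>_def jm(2) .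
qed

end
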